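(* Let $n\ge 3$, let $M,N\in\mathbb{Z}^{n-1}$ and let $D=(D_1,\dots,D_{n-1})$ be a tuple of positive integers. If $\gcd(D_1\cdots D_{n-2},D_{n-1})=1$, then the long Weyl element Kloosterman sums satisfy $$S_n(M,N;D)=S_{n-1}\big(M',(N_1,\dots,N_{n-2});(D_1,\dots,D_{n-2})\big)\cdot S_2(D_{n-2}M_{n-1},N_{n-1};D_{n-1}),$$ where $M'=(M_1,\dots,M_{n-3},D_{n-1}M_{n-2})$.
   Context: Definition of $S_n(M,N;D)$ for any $n\ge2$, $M,N\in\mathbb{Z}^{n-1}$ and $D$ an $(n-1)$-tuple of positive integers: $e(z)=e^{2\pi i z}$. $U$ is the group of upper triangular unipotent $n\times n$ matrices. For $N\in\mathbb{Z}^{n-1}$, $\psi_N$ is the character of $U(\mathbb{R})$, trivial on $U(\mathbb{Z})$, given by $\psi_N(u)=e(N_1u_{1,2}+N_2u_{2,3}+\cdots+N_{n-1}u_{n-1,n})$. For $M\in \mathbb{Z}^{n-1}$, $\tilde M=(M_{n-1},\dots,M_1)$. Let $w_0$ be the long Weyl element: the $n\times n$ matrix whose only nonzero entries are on the anti-diagonal, the entry at position $(n-k+1,k)$ being $(-1)^{k-1}$ ($1\le k\le n$). Let $c=\mathrm{Diag}(1/D_{n-1},\,D_{n-1}/D_{n-2},\dots,D_2/D_1,\,D_1)$, $C(c)=U(\mathbb{R})\,c\,w_0\,U(\mathbb{R})\cap SL(n,\mathbb{Z})$ and $X(c)=U(\mathbb{Z})\backslash C(c)/U(\mathbb{Z})$.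 Each $\gamma\in C(c)$ is uniquely $\gamma=b_1cw_0b_2$ with $b_1,b_2\in U(\mathbb{R})$; set $\mu(\gamma)=b_1\in U(\mathbb{Z})\backslash U(\mathbb{R})$ and $\mu'(\gamma)=b_2\in U(\mathbb{R})/U(\mathbb{Z})$. Then $$S_n(M,N;D)=\sum_{x\in X(c)}\psi_{\tilde M}(\mu(x))\,\psi_N(\mu'(x)).$$ For $n=2$ the arguments are integers (1-tuples). *)

theory Defs
  imports Complex_Main "Jordan_Normal_Form.Determinant"
begin

text \<open>
  Tuples of length \<open>n - 1\<close> are represented by functions on \<open>nat\<close> with entries at the
  indices \<open>1, \<dots>, n - 1\<close>; values at all other indices are ignored (see
  \<open>kloosterman_cong\<close> below). Thus dropping the last entry of a tuple needs no operation other
  than decreasing \<open>n\<close>. Matrix positions are counted from 0, so the entry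
  \<open>u\<^sub>k\<^sub>,\<^sub>k\<^sub>+\<^sub>1\<close> (counted from 1) is \<open>u $$ (k - 1, k)\<close>.
\<close>

definition e :: "real \<Rightarrow> complex" where
  "e z = exp (2 * complex_of_real pi * \<i> * complex_of_real z)"

definition unip_real :: "nat \<Rightarrow> real mat set" where
  "unip_real n = {u \<in> carrier_mat n n. upper_triangular u \<and> (\<forall>i<n. u $$ (i, i) = 1)}"

definition unip_int :: "nat \<Rightarrow> real mat set" where
  "unip_int n = {u \<in> unip_real n. \<forall>i<n. \<forall>j<n. u $$ (i, j) \<in> \<int>}"

definition SL_int :: "nat \<Rightarrow> real mat set" where
  "SL_int n = {g \<in> carrier_mat n n. (\<forall>i<n. \<forall>j<n. g $$ (i, j) \<in> \<int>) \<and> det g = 1}"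

definition psi :: "nat \<Rightarrow> (nat \<Rightarrow> int) \<Rightarrow> real mat \<Rightarrow> complex" where
  "psi n N u = e (\<Sum>k = 1..n - 1. of_int (N k) * u $$ (k - 1, k))"

definition rev_tuple :: "nat \<Rightarrow> (nat \<Rightarrow> int) \<Rightarrow> nat \<Rightarrow> int" where
  "rev_tuple n M = (\<lambda>k. M (n - k))"

definition long_weyl :: "nat \<Rightarrow> real mat" where
  "long_weyl n = mat n n (\<lambda>(i, j). if i + j + 1 = n then (-1) ^ j else 0)"

text \<open>
  With the convention \<open>D\<^sub>0 = D\<^sub>n = 1\<close>, the diagonal entries of \<open>c\<close>, counted from \<open>i = 0\<close>,
  are \<open>D\<^sub>n\<^sub>-\<^sub>i / D\<^sub>n\<^sub>-\<^sub>i\<^sub>-\<^sub>1\<close>.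
\<close>

definition ext :: "nat \<Rightarrow> (nat \<Rightarrow> nat) \<Rightarrow> nat \<Rightarrow> nat" where
  "ext n D k = (if 1 \<le> k \<and> k \<le> n - 1 then D k else 1)"

definition c_mat :: "nat \<Rightarrow> (nat \<Rightarrow> nat) \<Rightarrow> real mat" where
  "c_mat n D = mat_diag n (\<lambda>i. real (ext n D (n - i)) / real (ext n D (n - i - 1)))"

definition C_set :: "nat \<Rightarrow> (nat \<Rightarrow> nat) \<Rightarrow> real mat set" where
  "C_set n D =
     {b1 * c_mat n D * long_weyl n * b2 | b1 b2. b1 \<in> unip_real n \<and> b2 \<in> unip_real n} \<inter> SL_int n"

definition double_coset :: "nat \<Rightarrow> real mat \<Rightarrow> real mat set" where
  "double_coset n g = {u * g * v | u v. u \<in> unip_int n \<and> v \<in> unip_int n}"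

definition X_set :: "nat \<Rightarrow> (nat \<Rightarrow> nat) \<Rightarrow> real mat set set" where
  "X_set n D = double_coset n ` C_set n D"

text \<open>
  The two unipotent factors of the Bruhat decomposition \<open>g = b1 c w\<^sub>0 b2\<close>, which are unique for
  the long Weyl element. They are kept as matrices: replacing \<open>g\<close> by \<open>u g v\<close> with integral
  unipotent \<open>u\<close>, \<open>v\<close> replaces \<open>b1\<close> by \<open>u b1\<close> and \<open>b2\<close> by \<open>b2 v\<close>, which
  changes neither \<open>psi n N b1\<close> nor \<open>psi n N b2\<close>. Hence in the sum below the choice of a
  representative of each double coset is immaterial.
\<close>

definition mu :: "nat \<Rightarrow> (nat \<Rightarrow> nat) \<Rightarrow> real mat \<Rightarrow> real mat" where
  "mu n D g = (THE b1. b1 \<in> unip_real n \<and>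
     (\<exists>b2 \<in> unip_real n. g = b1 * c_mat n D * long_weyl n * b2))"

definition mu' :: "nat \<Rightarrow> (nat \<Rightarrow> nat) \<Rightarrow> real mat \<Rightarrow> real mat" where
  "mu' n D g = (THE b2. b2 \<in> unip_real n \<and>
     (\<exists>b1 \<in> unip_real n. g = b1 * c_mat n D * long_weyl n * b2))"

definition kloosterman :: "nat \<Rightarrow> (nat \<Rightarrow> int) \<Rightarrow> (nat \<Rightarrow> int) \<Rightarrow> (nat \<Rightarrow> nat) \<Rightarrow> complex" where
  "kloosterman n M N D =
     (\<Sum>x \<in> X_set n D. let g = (SOME g. g \<in> x)
        in psi n (rev_tuple n M) (mu n D g) * psi n N (mu' n D g))"

lemma kloosterman_cong:
  assumes "\<And>k. 1 \<le> k \<Longrightarrow> k \<le> n - 1 \<Longrightarrow> M k = M' k"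
    and "\<And>k. 1 \<le> k \<Longrightarrow> k \<le> n - 1 \<Longrightarrow> N k = N' k"
    and "\<And>k. 1 \<le> k \<Longrightarrow> k \<le> n - 1 \<Longrightarrow> D k = D' k"
  shows "kloosterman n M N D = kloosterman n M' N' D'"
proof -
  have ext: "ext n D = ext n D'"
    using assms(3) by (auto simp: ext_def fun_eq_iff)
  have c: "c_mat n D = c_mat n D'"
    by (simp add: c_mat_def ext)
  have X: "X_set n D = X_set n D'"
    by (simp add: X_set_def C_set_def c)
  have m: "mu n D = mu n D'" "mu' n D = mu' n D'"
    by (simp_all add: mu_def mu'_def c fun_eq_iff)
  have pM: "psi n (rev_tuple n M) = psi n (rev_tuple n M')"
    unfolding psi_def fun_eq_iff rev_tuple_def
    by (intro allI arg_cong[where f = e] sum.cong refl, subst assms(1)) auto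
  have pN: "psi n N = psi n N'"
    unfolding psi_def fun_eq_iff
    by (intro allI arg_cong[where f = e] sum.cong refl) (simp add: assms(2))
  show ?thesis
    by (simp add: kloosterman_def X m pM pN)
qed

end

theory Submission
  imports Defs "HOL-Number_Theory.Cong"
begin

text \<open>
  Put \<open>m = n - 1\<close>, \<open>d = D\<^sub>m\<close>, \<open>a = D\<^sub>m\<^sub>-\<^sub>1\<close>. Given \<open>g\<close> of size \<open>m\<close> with invariants
  \<open>D\<^sub>1, \<dots>, D\<^sub>m\<^sub>-\<^sub>1\<close> and \<open>h\<close> of size 2 with invariant \<open>d\<close>, the product
  \<open>diag(h, 1, \<dots>, 1) P diag(g, 1)\<close>, where \<open>P\<close> is the signed permutation matrix that moves the last
  coordinate to the second place, has invariants \<open>D\<^sub>1, \<dots>, D\<^sub>m\<close>, and its Bruhat factors are read off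
  from those of \<open>g\<close> and \<open>h\<close>. Conversely, the lower left \<open>m \<times> m\<close> block \<open>A\<close> of a matrix with these
  invariants has determinant \<open>d\<close>, and the rows of \<open>A\<close> below the first have a maximal minor \<open>a\<close>.
  As \<open>a\<close> and \<open>d\<close> are coprime, these rows can be completed to a \<open>g\<close> of determinant 1, and
  the rest of the matrix then determines \<open>h\<close>. So double cosets of size \<open>n\<close> correspond to pairs of
  double cosets of sizes \<open>m\<close> and 2, and the characters multiply.
\<close>

subsection \<open>Integral and unipotent matrices\<close>

definition int_mat :: "real mat \<Rightarrow> bool" where
  "int_mat A \<longleftrightarrow> (\<forall>i<dim_row A. \<forall>j<dim_col A. A $$ (i, j) \<in> \<int>)"

lemma int_mat_mult:
  assumes "int_mat A" "int_mat B" "dim_col A = dim_row B"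
  shows "int_mat (A * B)"
  using assms unfolding int_mat_def
  by (auto simp: scalar_prod_def intro!: Ints_mult)

lemma int_mat_one [simp]: "int_mat (1\<^sub>m n)"
  by (auto simp: int_mat_def one_mat_def)

lemma int_mat_four_block:
  assumes "int_mat A" "int_mat B" "int_mat C" "int_mat D"
    and "dim_row A = dim_row B" "dim_row C = dim_row D" "dim_col A = dim_col C" "dim_col B = dim_col D"
  shows "int_mat (four_block_mat A B C D)"
  using assms unfolding int_mat_def by auto

lemma int_mat_det:
  assumes "int_mat A" "A \<in> carrier_mat n n"
  shows "det A \<in> \<int>"
proof -
  have "A $$ (i, p i) \<in> \<int>" if "p permutes {0..<n}" "i < n" for p i
    using assms that permutes_in_image[OF that(1), of i] by (auto simp: int_mat_def)
  then show ?thesis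
    using assms(2) unfolding det_def
    by (auto intro!: Ints_sum Ints_mult Ints_prod simp: sign_def)
qed

lemma int_mat_delete:
  assumes "int_mat A" "A \<in> carrier_mat n n" "i < n" "j < n"
  shows "int_mat (mat_delete A i j)"
  using assms unfolding int_mat_def mat_delete_def by auto

lemma int_mat_cofactor:
  assumes "int_mat A" "A \<in> carrier_mat n n" "i < n" "j < n"
  shows "cofactor A i j \<in> \<int>"
  unfolding cofactor_def
  using int_mat_det[OF int_mat_delete[OF assms] mat_delete_carrier[OF assms(2)]] by simp

lemma SL_int_iff: "g \<in> SL_int n \<longleftrightarrow> g \<in> carrier_mat n n \<and> int_mat g \<and> det g = 1"
  by (auto simp: SL_int_def int_mat_def)

lemma SL_int_mult: "g \<in> SL_int n \<Longrightarrow> h \<in> SL_int n \<Longrightarrow> g * h \<in> SL_int n"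
  by (auto simp: SL_int_iff det_mult intro!: int_mat_mult)

text \<open>The inverse is the adjugate, whose entries are cofactors and hence integral.\<close>

lemma SL_int_inverse:
  assumes "g \<in> SL_int n"
  obtains g' where "g' \<in> SL_int n" "g * g' = 1\<^sub>m n" "g' * g = 1\<^sub>m n"
proof
  have g: "g \<in> carrier_mat n n" "int_mat g" "det g = 1"
    using assms by (auto simp: SL_int_iff)
  show 1: "g * adj_mat g = 1\<^sub>m n" "adj_mat g * g = 1\<^sub>m n"
    using adj_mat[OF g(1)] g(3) by auto
  have "int_mat (adj_mat g)"
    using g int_mat_cofactor[OF g(2,1)] by (auto simp: int_mat_def adj_mat_def)
  moreover have "det (adj_mat g) = 1"
    using arg_cong[OF 1(1), of det] g det_mult[OF g(1) adj_mat(1)[OF g(1)]] by simp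
  ultimately show "adj_mat g \<in> SL_int n"
    using adj_mat(1)[OF g(1)] by (simp add: SL_int_iff)
qed

lemma unip_real_iff:
  "u \<in> unip_real n \<longleftrightarrow> u \<in> carrier_mat n n \<and>
     (\<forall>i<n. \<forall>j<n. j \<le> i \<longrightarrow> u $$ (i, j) = (if i = j then 1 else 0))"
  unfolding unip_real_def upper_triangular_def by (auto simp: le_less)

lemma unip_int_iff: "u \<in> unip_int n \<longleftrightarrow> u \<in> unip_real n \<and> int_mat u"
  by (auto simp: unip_int_def unip_real_def int_mat_def)

lemma unip_real_carrier: "u \<in> unip_real n \<Longrightarrow> u \<in> carrier_mat n n"
  by (simp add: unip_real_def)

lemma unip_real_one [simp]: "1\<^sub>m n \<in> unip_real n"
  by (auto simp: unip_real_iff)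

lemma unip_int_one [simp]: "1\<^sub>m n \<in> unip_int n"
  by (simp add: unip_int_iff)

lemma unip_real_det:
  assumes "u \<in> unip_real n"
  shows "det u = 1"
proof -
  have u: "u \<in> carrier_mat n n" "upper_triangular u" "\<forall>i<n. u $$ (i, i) = 1"
    using assms by (auto simp: unip_real_def)
  have "diag_mat u = replicate n 1"
    using u by (intro nth_equalityI) (auto simp: diag_mat_def)
  then show ?thesis
    using det_upper_triangular[OF u(2,1)] by simp
qed

lemma unip_int_SL: "u \<in> unip_int n \<Longrightarrow> u \<in> SL_int n"
  by (auto simp: SL_int_iff unip_int_iff unip_real_carrier unip_real_det)

lemma unip_real_mult:
  assumes "u \<in> unip_real n" "v \<in> unip_real n"
  shows "u * v \<in> unip_real n"
proof -
  have c: "u \<in> carrier_mat n n" "v \<in> carrier_mat n n"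
    using assms by (auto simp: unip_real_carrier)
  have "(u * v) $$ (i, j) = (if i = j then 1 else 0)" if "i < n" "j < n" "j \<le> i" for i j
  proof -
    have "(u * v) $$ (i, j) = (\<Sum>k\<in>{0..<n}. u $$ (i, k) * v $$ (k, j))"
      using c that by (auto simp: scalar_prod_def)
    also have "\<dots> = (\<Sum>k\<in>{0..<n}. if k = i then (if i = j then 1 else 0) else 0)"
    proof (intro sum.cong refl)
      fix k assume k: "k \<in> {0..<n}"
      show "u $$ (i, k) * v $$ (k, j) = (if k = i then (if i = j then 1 else 0) else 0)"
      proof (cases "k < i")
        case True
        then show ?thesis using assms(1) that k by (auto simp: unip_real_iff)
      next
        case False
        then show ?thesis using assms that k by (cases "k = i") (auto simp: unip_real_iff)
      qed
    qed
    finally show ?thesis using that by simp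
  qed
  then show ?thesis using c by (simp add: unip_real_iff)
qed

lemma unip_int_mult: "u \<in> unip_int n \<Longrightarrow> v \<in> unip_int n \<Longrightarrow> u * v \<in> unip_int n"
  using unip_real_carrier[of u n] unip_real_carrier[of v n]
  by (simp add: unip_int_iff unip_real_mult int_mat_mult)

text \<open>Additivity on the superdiagonal is what makes \<open>psi\<close> a character; by
  triangularity only the summation indices \<open>k\<close> and \<open>Suc k\<close>
  survive.\<close>

lemma unip_real_superdiag_mult:
  assumes "u \<in> unip_real n" "v \<in> unip_real n" "Suc k < n"
  shows "(u * v) $$ (k, Suc k) = u $$ (k, Suc k) + v $$ (k, Suc k)"
proof -
  have c: "u \<in> carrier_mat n n" "v \<in> carrier_mat n n"
    using assms by (auto simp: unip_real_carrier)
  have "(u * v) $$ (k, Suc k) = (\<Sum>l\<in>{0..<n}. u $$ (k, l) * v $$ (l, Suc k))"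
    using c assms(3) by (auto simp: scalar_prod_def)
  also have "\<dots> = (\<Sum>l\<in>{k, Suc k}. u $$ (k, l) * v $$ (l, Suc k))"
  proof (intro sum.mono_neutral_right ballI)
    fix l assume "l \<in> {0..<n} - {k, Suc k}"
    then have "l < k \<or> Suc k < l" "l < n" by auto
    then show "u $$ (k, l) * v $$ (l, Suc k) = 0"
      using assms by (auto simp: unip_real_iff)
  qed (use assms(3) in auto)
  also have "\<dots> = u $$ (k, Suc k) + v $$ (k, Suc k)"
    using assms by (simp add: unip_real_iff)
  finally show ?thesis .
qed

lemma unip_real_inverse:
  assumes u: "u \<in> unip_real n"
  obtains u' where "u' \<in> unip_real n" "u * u' = 1\<^sub>m n" "u' * u = 1\<^sub>m n" "int_mat u \<Longrightarrow> int_mat u'"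
proof -
  have c: "u \<in> carrier_mat n n" using u by (rule unip_real_carrier)
  define B where "B = adj_mat u"
  have B: "B \<in> carrier_mat n n" "u * B = 1\<^sub>m n" "B * u = 1\<^sub>m n"
    using adj_mat[OF c] unip_real_det[OF u] by (auto simp: B_def)
  \<comment> \<open>From the bottom row upwards: in row \<open>i\<close> of \<open>u * B = 1\<close>
    the terms with \<open>k < i\<close> vanish by triangularity of \<open>u\<close> and those with
    \<open>k > i\<close> by induction, which leaves \<open>B $$ (i, j)\<close>.\<close>
  have "B $$ (i, j) = (if i = j then 1 else 0)" if "i < n" "j < n" "j \<le> i" for i j
    using that
  proof (induction "n - i" arbitrary: i rule: less_induct)
    case less
    have "(if i = j then 1 else 0) = (u * B) $$ (i, j)"
      using B(2) less.prems by simp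
    also have "\<dots> = (\<Sum>k\<in>{0..<n}. u $$ (i, k) * B $$ (k, j))"
      using c B(1) less.prems by (auto simp: scalar_prod_def)
    also have "\<dots> = (\<Sum>k\<in>{0..<n}. if k = i then B $$ (i, j) else 0)"
    proof (intro sum.cong refl)
      fix k assume k: "k \<in> {0..<n}"
      consider "k < i" | "k = i" | "i < k" by linarith
      then show "u $$ (i, k) * B $$ (k, j) = (if k = i then B $$ (i, j) else 0)"
      proof cases
        case 3
        then have "B $$ (k, j) = 0"
          using less.hyps[of k] less.prems k by auto
        then show ?thesis using 3 by simp
      qed (use u less.prems k in \<open>auto simp: unip_real_iff\<close>)
    qed
    finally show ?case using less.prems by simp
  qed
  then have "B \<in> unip_real n" using B by (simp add: unip_real_iff)
  moreover have "int_mat B" if "int_mat u"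
    using c int_mat_cofactor[OF that c] by (auto simp: int_mat_def B_def adj_mat_def)
  ultimately show ?thesis using that[of B] B by blast
qed

lemma unip_int_inverse:
  assumes "u \<in> unip_int n"
  obtains u' where "u' \<in> unip_int n" "u * u' = 1\<^sub>m n" "u' * u = 1\<^sub>m n"
  using assms unip_real_inverse[of u n] unfolding unip_int_iff by metis

text \<open>Left factors are split at the first row and right factors at the last column, because
  the lower left block of a Bruhat product sees only what then remains of each factor.\<close>

lemma unip_real_four_block_left:
  assumes "u \<in> unip_real m" "r \<in> carrier_mat 1 m"
  shows "four_block_mat (1\<^sub>m 1) r (0\<^sub>m m 1) u \<in> unip_real (Suc m)"
  using assms by (auto simp: unip_real_iff)

lemma unip_real_four_block_right:
  assumes "v \<in> unip_real m" "s \<in> carrier_mat m 1"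
  shows "four_block_mat v s (0\<^sub>m 1 m) (1\<^sub>m 1) \<in> unip_real (Suc m)"
  using assms by (auto simp: unip_real_iff)

lemma unip_real_split_left:
  assumes u: "u \<in> unip_real (Suc m)"
  obtains r u' where "r \<in> carrier_mat 1 m" "u' \<in> unip_real m"
    "u = four_block_mat (1\<^sub>m 1) r (0\<^sub>m m 1) u'" "int_mat u \<Longrightarrow> int_mat r \<and> int_mat u'"
proof
  let ?r = "mat 1 m (\<lambda>(i, j). u $$ (i, Suc j))" and ?u = "mat m m (\<lambda>(i, j). u $$ (Suc i, Suc j))"
  show "u = four_block_mat (1\<^sub>m 1) ?r (0\<^sub>m m 1) ?u"
    using u by (intro eq_matI) (auto simp: unip_real_iff)
  show "int_mat u \<Longrightarrow> int_mat ?r \<and> int_mat ?u"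
    using unip_real_carrier[OF u] by (auto simp: int_mat_def)
qed (use u in \<open>auto simp: unip_real_iff\<close>)

lemma unip_real_split_right:
  assumes v: "v \<in> unip_real (Suc m)"
  obtains s v' where "s \<in> carrier_mat m 1" "v' \<in> unip_real m"
    "v = four_block_mat v' s (0\<^sub>m 1 m) (1\<^sub>m 1)" "int_mat v \<Longrightarrow> int_mat s \<and> int_mat v'"
proof
  let ?s = "mat m 1 (\<lambda>(i, j). v $$ (i, m))" and ?v = "mat m m (\<lambda>(i, j). v $$ (i, j))"
  show "v = four_block_mat ?v ?s (0\<^sub>m 1 m) (1\<^sub>m 1)"
  proof (intro eq_matI)
    fix i j
    assume "i < dim_row (four_block_mat ?v ?s (0\<^sub>m 1 m) (1\<^sub>m 1))"
      "j < dim_col (four_block_mat ?v ?s (0\<^sub>m 1 m) (1\<^sub>m 1))"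
    then have ij: "i < Suc m" "j < Suc m" by auto
    then consider "i < m" "j < m" | "i < m" "j = m" | "i = m" "j < m" | "i = m" "j = m"
      by linarith
    then show "v $$ (i, j) = four_block_mat ?v ?s (0\<^sub>m 1 m) (1\<^sub>m 1) $$ (i, j)"
      using v by cases (auto simp: unip_real_iff)
  qed (use v in \<open>auto simp: unip_real_iff\<close>)
  show "int_mat v \<Longrightarrow> int_mat ?s \<and> int_mat ?v"
    using unip_real_carrier[OF v] by (auto simp: int_mat_def)
qed (use v in \<open>auto simp: unip_real_iff\<close>)

subsection \<open>Bruhat factors and double cosets\<close>

lemma mult_square_carrier: "A \<in> carrier_mat n n \<Longrightarrow> B \<in> carrier_mat n n \<Longrightarrow> A * B \<in> carrier_mat n n"
  by (rule mult_carrier_mat)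

text \<open>Cancels an inverse pair once \<open>assoc_mult_mat\<close> has bracketed a product to
  the right; \<open>C\<close> may be a column.\<close>

lemma mult_inverse_cancel:
  fixes A :: "real mat"
  assumes "A \<in> carrier_mat n n" "B \<in> carrier_mat n n" "C \<in> carrier_mat n k" "A * B = 1\<^sub>m n"
  shows "A * (B * C) = C"
  using assms assoc_mult_mat[of A n n B n C k] by simp

lemma e_add: "e (x + y) = e x * e y"
  by (simp add: e_def ring_distribs exp_add)

lemma e_Ints: "x \<in> \<int> \<Longrightarrow> e x = 1"
  using cis_multiple_2pi[of x] by (simp add: e_def cis_conv_exp mult_ac)

lemma psi_mult:
  assumes "u \<in> unip_real n" "v \<in> unip_real n"
  shows "psi n N (u * v) = psi n N u * psi n N v"
proof -
  have "(u * v) $$ (k - 1, k) = u $$ (k - 1, k) + v $$ (k - 1, k)" if "k \<in> {1..n - 1}" for k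
    using unip_real_superdiag_mult[OF assms, of "k - 1"] that by auto
  then have "(\<Sum>k = 1..n - 1. of_int (N k) * (u * v) $$ (k - 1, k))
    = (\<Sum>k = 1..n - 1. of_int (N k) * u $$ (k - 1, k) + of_int (N k) * v $$ (k - 1, k))"
    by (intro sum.cong) (auto simp: ring_distribs)
  then show ?thesis
    by (simp add: psi_def sum.distrib flip: e_add)
qed

lemma psi_unip_int: "u \<in> unip_int n \<Longrightarrow> psi n N u = 1"
  unfolding psi_def by (rule e_Ints) (auto simp: unip_int_def intro!: Ints_sum Ints_mult)

text \<open>The shape of \<open>c_mat n D * long_weyl n\<close>. Weights are indexed by column, so
  that enlarging the matrix keeps \<open>f\<close>: the old matrix becomes the lower left
  block.\<close>

definition antidiag :: "nat \<Rightarrow> (nat \<Rightarrow> real) \<Rightarrow> real mat" where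
  "antidiag n f = mat n n (\<lambda>(i, j). if i + j + 1 = n then (-1) ^ j * f j else 0)"

lemma antidiag_carrier [simp]: "antidiag n f \<in> carrier_mat n n"
  by (simp add: antidiag_def)

lemma antidiag_dim [simp]: "dim_row (antidiag n f) = n" "dim_col (antidiag n f) = n"
  by (simp_all add: antidiag_def)

lemma antidiag_Suc:
  "antidiag (Suc m) f =
     four_block_mat (0\<^sub>m 1 m) (mat 1 1 (\<lambda>_. (-1) ^ m * f m)) (antidiag m f) (0\<^sub>m m 1)"
  by (rule eq_matI) (auto simp: antidiag_def less_Suc_eq)

text \<open>Each new corner entry carries the sign \<open>(-1) ^ m\<close>, which cancels the sign
  from moving its column past the other \<open>m\<close> columns.\<close>

lemma det_antidiag: "det (antidiag n f) = (\<Prod>j<n. f j)"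
proof (induction n)
  case 0
  then show ?case by (simp add: antidiag_def)
next
  case (Suc m)
  have "det (antidiag (Suc m) f) = (-1) ^ m * det (mat 1 1 (\<lambda>_. (-1) ^ m * f m)) * det (antidiag m f)"
    unfolding antidiag_Suc by (rule det_four_block_mat_lower_right_zero_col) auto
  also have "\<dots> = (\<Prod>j<Suc m. f j)"
    by (simp add: det_single Suc.IH flip: power_mult_distrib mult.assoc)
  finally show ?case .
qed

text \<open>For \<open>j < n\<close>, the diagonal entry of \<open>c_mat\<close> in row
  \<open>n - 1 - j\<close>, the row where column \<open>j\<close> of \<open>long_weyl\<close> is
  nonzero.\<close>

definition ratio :: "nat \<Rightarrow> (nat \<Rightarrow> nat) \<Rightarrow> nat \<Rightarrow> real" where
  "ratio n D j = real (ext n D (Suc j)) / real (ext n D j)"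

lemma c_mat_long_weyl: "c_mat n D * long_weyl n = antidiag n (ratio n D)"
proof -
  have "n - i = Suc j \<and> n - i - 1 = j" if "i + j + 1 = n" for i j
    using that by auto
  then show ?thesis
    unfolding c_mat_def
    by (subst mat_diag_mult_left[where nr = n])
      (auto simp: long_weyl_def antidiag_def ratio_def intro!: eq_matI)
qed

lemma bruhat_eq:
  assumes "b1 \<in> unip_real n"
  shows "b1 * c_mat n D * long_weyl n * b2 = b1 * antidiag n (ratio n D) * b2"
proof -
  have "b1 * c_mat n D * long_weyl n = b1 * (c_mat n D * long_weyl n)"
    using unip_real_carrier[OF assms(1)]
    by (intro assoc_mult_mat[of b1 n n _ n _ n]) (auto simp: c_mat_def long_weyl_def)
  then show ?thesis by (simp add: c_mat_long_weyl)
qed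

lemma antidiag_mult_left_index:
  assumes "A \<in> carrier_mat n k" "i < n" "j < k"
  shows "(antidiag n f * A) $$ (i, j) = (-1) ^ (n - 1 - i) * f (n - 1 - i) * A $$ (n - 1 - i, j)"
proof -
  have "(antidiag n f * A) $$ (i, j) = (\<Sum>l\<in>{0..<n}. antidiag n f $$ (i, l) * A $$ (l, j))"
    using assms by (simp add: scalar_prod_def)
  also have "\<dots> = (\<Sum>l\<in>{0..<n}. if l = n - 1 - i then (-1) ^ l * f l * A $$ (l, j) else 0)"
    using assms by (intro sum.cong) (auto simp: antidiag_def)
  finally show ?thesis
    using assms by simp
qed

lemma antidiag_mult_right_index:
  assumes "A \<in> carrier_mat k n" "i < k" "j < n"
  shows "(A * antidiag n f) $$ (i, j) = A $$ (i, n - 1 - j) * ((-1) ^ j * f j)"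
proof -
  have "(A * antidiag n f) $$ (i, j) = (\<Sum>l\<in>{0..<n}. A $$ (i, l) * antidiag n f $$ (l, j))"
    using assms by (simp add: scalar_prod_def)
  also have "\<dots> = (\<Sum>l\<in>{0..<n}. if l = n - 1 - j then A $$ (i, l) * ((-1) ^ j * f j) else 0)"
    using assms by (intro sum.cong) (auto simp: antidiag_def)
  finally show ?thesis
    using assms by simp
qed

text \<open>With \<open>i1\<close> and \<open>i2\<close> the inverses of \<open>b1'\<close> and
  \<open>b2\<close>, the equation becomes \<open>i1 * b1 * ?W = ?W * (b2' * i2)\<close>. Passing
  across an antidiagonal matrix turns upper into lower triangular matrices, so the unipotent matrix
  \<open>i1 * b1\<close> is both and equals 1.\<close>

lemma bruhat_unique:
  assumes f: "\<And>j. j < n \<Longrightarrow> f j \<noteq> 0"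
    and b: "b1 \<in> unip_real n" "b2 \<in> unip_real n" "b1' \<in> unip_real n" "b2' \<in> unip_real n"
    and eq: "b1 * antidiag n f * b2 = b1' * antidiag n f * b2'"
  shows "b1 = b1'" "b2 = b2'"
proof -
  let ?W = "antidiag n f"
  obtain i1 where i1: "i1 \<in> unip_real n" "i1 * b1' = 1\<^sub>m n" "b1' * i1 = 1\<^sub>m n"
    using unip_real_inverse[OF b(3)] by metis
  obtain i2 where i2: "i2 \<in> unip_real n" "b2 * i2 = 1\<^sub>m n"
    using unip_real_inverse[OF b(2)] by metis
  note c [simp] = b[THEN unip_real_carrier] i1(1)[THEN unip_real_carrier] i2(1)[THEN unip_real_carrier]
  have u: "i1 * b1 \<in> unip_real n" and v: "b2' * i2 \<in> unip_real n"
    using b i1 i2 by (auto intro: unip_real_mult)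
  note uc = unip_real_carrier[OF u] and vc = unip_real_carrier[OF v]
  note sq = mult_square_carrier[where n = n] assoc_mult_mat[of _ n n _ n _ n]
  have "i1 * b1 * ?W = i1 * (b1 * ?W * b2) * i2"
    using c i2(2) by (simp add: sq)
  also have "\<dots> = ?W * (b2' * i2)"
    unfolding eq using c i1(2) by (simp add: sq mult_inverse_cancel[of i1 n b1' _ n])
  finally have uv: "i1 * b1 * ?W = ?W * (b2' * i2)" .
  \<comment> \<open>Reflection by \<open>?W\<close> sends the position \<open>(i, k)\<close> above
    the diagonal to \<open>(n - 1 - i, n - 1 - k)\<close> below it, where \<open>b2' * i2\<close>
    vanishes.\<close>
  have "(i1 * b1) $$ (i, k) = 0" if "i < k" "k < n" for i k
  proof -
    have "(i1 * b1) $$ (i, k) * ((-1) ^ (n - 1 - k) * f (n - 1 - k))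
      = (-1) ^ (n - 1 - i) * f (n - 1 - i) * (b2' * i2) $$ (n - 1 - i, n - 1 - k)"
      using arg_cong[OF uv, of "\<lambda>A. A $$ (i, n - 1 - k)"] that
        antidiag_mult_left_index[OF vc, of i "n - 1 - k" f] antidiag_mult_right_index[OF uc, of i "n - 1 - k" f]
      by simp
    moreover have "(b2' * i2) $$ (n - 1 - i, n - 1 - k) = 0"
      using v that unfolding unip_real_iff by auto
    ultimately show ?thesis using f[of "n - 1 - k"] that by simp
  qed
  then have "(i1 * b1) $$ (i, k) = 1\<^sub>m n $$ (i, k)" if "i < n" "k < n" for i k
    using u that unfolding unip_real_iff by (cases "i < k") auto
  then have "i1 * b1 = 1\<^sub>m n"
    using uc by (intro eq_matI) auto
  then have "b1' * (i1 * b1) = b1'" by (simp add: right_mult_one_mat[of _ n n])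
  then show b1: "b1 = b1'"
    using i1(3) by (simp add: mult_inverse_cancel[of b1' n i1 _ n])
  have W: "?W * b2 = ?W * b2'"
  proof -
    have "i1 * (b1' * (?W * b2)) = i1 * (b1' * (?W * b2'))"
      using eq unfolding b1 by (simp add: sq)
    then show ?thesis
      using i1(2) by (simp add: sq mult_inverse_cancel[of i1 n b1' _ n])
  qed
  \<comment> \<open>Left multiplication by \<open>?W\<close> only reverses the rows and rescales
    them by nonzero factors, so \<open>?W\<close> cancels.\<close>
  show "b2 = b2'"
  proof (rule eq_matI)
    fix i j assume "i < dim_row b2'" "j < dim_col b2'"
    then have ij: "i < n" "j < n" using c by auto
    then show "b2 $$ (i, j) = b2' $$ (i, j)"
      using arg_cong[OF W, of "\<lambda>A. A $$ (n - 1 - i, j)"] f[of i]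
        antidiag_mult_left_index[OF c(2), of "n - 1 - i" j f] antidiag_mult_left_index[OF c(4), of "n - 1 - i" j f]
      by simp
  qed (simp_all only: carrier_matD[OF c(2)] carrier_matD[OF c(4)])
qed

lemma C_set_iff:
  "g \<in> C_set n D \<longleftrightarrow> g \<in> SL_int n \<and>
     (\<exists>b1\<in>unip_real n. \<exists>b2\<in>unip_real n. g = b1 * antidiag n (ratio n D) * b2)"
proof -
  have "{b1 * c_mat n D * long_weyl n * b2 | b1 b2. b1 \<in> unip_real n \<and> b2 \<in> unip_real n}
    = {b1 * antidiag n (ratio n D) * b2 | b1 b2. b1 \<in> unip_real n \<and> b2 \<in> unip_real n}"
    by (intro Collect_cong ex_cong1) (auto simp: bruhat_eq)
  then show ?thesis unfolding C_set_def by blast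
qed

definition pos_tuple :: "nat \<Rightarrow> (nat \<Rightarrow> nat) \<Rightarrow> bool" where
  "pos_tuple n D \<longleftrightarrow> (\<forall>k. 1 \<le> k \<and> k \<le> n - 1 \<longrightarrow> D k > 0)"

lemma ext_pos: "pos_tuple n D \<Longrightarrow> ext n D k > 0"
  by (simp add: pos_tuple_def ext_def)

lemma ratio_nonzero: "pos_tuple n D \<Longrightarrow> ratio n D j \<noteq> 0"
  using ext_pos[of n D] by (simp add: ratio_def)

text \<open>Telescoping from \<open>ext n D 0 = 1\<close>. Together with \<open>det_antidiag\<close>
  this identifies the lower left corner minors of a Bruhat product with the
  \<open>D k\<close>.\<close>

lemma prod_ratio:
  assumes "pos_tuple n D"
  shows "(\<Prod>j<k. ratio n D j) = real (ext n D k)"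
proof (induction k)
  case 0
  show ?case by (simp add: ext_def)
next
  case (Suc k)
  then show ?case using ext_pos[OF assms, of k] by (simp add: ratio_def)
qed

lemma mu_bruhat:
  assumes "pos_tuple n D" "b1 \<in> unip_real n" "b2 \<in> unip_real n"
    and "g = b1 * antidiag n (ratio n D) * b2"
  shows "mu n D g = b1" "mu' n D g = b2"
proof -
  note un = bruhat_unique[of n "ratio n D", OF ratio_nonzero[OF assms(1)]]
  show "mu n D g = b1"
    unfolding mu_def
  proof (rule the_equality)
    show "b1 \<in> unip_real n \<and> (\<exists>b2\<in>unip_real n. g = b1 * c_mat n D * long_weyl n * b2)"
      using assms by (auto simp: bruhat_eq)
    fix b assume "b \<in> unip_real n \<and> (\<exists>b2\<in>unip_real n. g = b * c_mat n D * long_weyl n * b2)"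
    then show "b = b1" using un(1) assms by (auto simp: bruhat_eq)
  qed
  show "mu' n D g = b2"
    unfolding mu'_def
  proof (rule the_equality)
    show "b2 \<in> unip_real n \<and> (\<exists>b1\<in>unip_real n. g = b1 * c_mat n D * long_weyl n * b2)"
      using assms by (auto simp: bruhat_eq)
    fix b assume "b \<in> unip_real n \<and> (\<exists>b1\<in>unip_real n. g = b1 * c_mat n D * long_weyl n * b)"
    then show "b = b2" using un(2) assms by (auto simp: bruhat_eq)
  qed
qed

text \<open>The determinant is automatically 1, since the product of all ratios telescopes to
  \<open>ext n D n = 1\<close>; membership reduces to integrality.\<close>

lemma bruhat_SL:
  assumes "pos_tuple n D" "b1 \<in> unip_real n" "b2 \<in> unip_real n"
    and "g = b1 * antidiag n (ratio n D) * b2" "int_mat g" "n > 0"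
  shows "g \<in> C_set n D"
proof -
  note c = assms(2,3)[THEN unip_real_carrier]
  have "det g = det b1 * det (antidiag n (ratio n D)) * det b2"
    unfolding assms(4) using c by (simp add: det_mult[of _ n])
  moreover have "ext n D n = 1"
    using assms(6) by (auto simp: ext_def)
  ultimately have "det g = 1"
    using assms by (simp add: unip_real_det det_antidiag prod_ratio)
  then show ?thesis
    using assms c by (auto simp: C_set_iff SL_int_iff)
qed

lemma C_set_translate:
  assumes D: "pos_tuple n D" and g: "g \<in> C_set n D" and uv: "u \<in> unip_int n" "v \<in> unip_int n"
  shows "u * g * v \<in> C_set n D" "mu n D (u * g * v) = u * mu n D g"
    "mu' n D (u * g * v) = mu' n D g * v"
proof -
  obtain b1 b2 where b: "b1 \<in> unip_real n" "b2 \<in> unip_real n" "g = b1 * antidiag n (ratio n D) * b2"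
    using g by (auto simp: C_set_iff)
  have uv': "u \<in> unip_real n" "v \<in> unip_real n" using uv by (auto simp: unip_int_iff)
  note [simp] = b(1,2)[THEN unip_real_carrier] uv'[THEN unip_real_carrier]
  have eq: "u * g * v = (u * b1) * antidiag n (ratio n D) * (b2 * v)"
    unfolding b(3) by (simp add: mult_square_carrier[where n = n] assoc_mult_mat[of _ n n _ n _ n])
  have m: "u * b1 \<in> unip_real n" "b2 * v \<in> unip_real n"
    using b uv' by (auto intro: unip_real_mult)
  show "u * g * v \<in> C_set n D"
    unfolding C_set_iff using g m eq uv by (blast intro: SL_int_mult unip_int_SL dest: C_set_iff[THEN iffD1])
  show "mu n D (u * g * v) = u * mu n D g" "mu' n D (u * g * v) = mu' n D g * v"
    using mu_bruhat[OF D m eq] mu_bruhat[OF D b] by auto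
qed

section \<open>The summand and its invariance on double cosets\<close>

definition phase :: "nat \<Rightarrow> (nat \<Rightarrow> int) \<Rightarrow> (nat \<Rightarrow> int) \<Rightarrow> (nat \<Rightarrow> nat) \<Rightarrow> real mat \<Rightarrow> complex" where
  "phase n M N D g = psi n (rev_tuple n M) (mu n D g) * psi n N (mu' n D g)"

lemma mem_double_cosetD:
  assumes "pos_tuple n D" "g \<in> C_set n D" "g' \<in> double_coset n g"
  shows "g' \<in> C_set n D" "phase n M N D g' = phase n M N D g"
proof -
  obtain u v where uv: "u \<in> unip_int n" "v \<in> unip_int n" "g' = u * g * v"
    using assms(3) by (auto simp: double_coset_def)
  note t = C_set_translate[OF assms(1,2) uv(1,2)]
  show "g' \<in> C_set n D" using t uv by simp
  obtain b1 b2 where b: "b1 \<in> unip_real n" "b2 \<in> unip_real n" "g = b1 * antidiag n (ratio n D) * b2"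
    using assms(2) by (auto simp: C_set_iff)
  have "mu n D g \<in> unip_real n" "mu' n D g \<in> unip_real n"
    using mu_bruhat[OF assms(1) b] b by auto
  then show "phase n M N D g' = phase n M N D g"
    using t uv by (simp add: phase_def psi_mult psi_unip_int unip_int_iff)
qed

lemma double_coset_refl: "g \<in> carrier_mat n n \<Longrightarrow> g \<in> double_coset n g"
  unfolding double_coset_def
  by (auto intro!: exI[of _ "1\<^sub>m n"])

lemma double_coset_trans:
  assumes "g \<in> carrier_mat n n" "h \<in> double_coset n g" "k \<in> double_coset n h"
  shows "k \<in> double_coset n g"
proof -
  obtain u v u' v' where uv: "u \<in> unip_int n" "v \<in> unip_int n" "h = u * g * v"
    "u' \<in> unip_int n" "v' \<in> unip_int n" "k = u' * h * v'"
    using assms by (auto simp: double_coset_def)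
  note [simp] = uv(1,2,4,5)[THEN unip_int_SL, unfolded SL_int_iff, THEN conjunct1] assms(1)
  have "k = (u' * u) * g * (v * v')"
    unfolding uv by (simp add: mult_square_carrier[where n = n] assoc_mult_mat[of _ n n _ n _ n])
  then show ?thesis
    using uv unip_int_mult unfolding double_coset_def by blast
qed

lemma double_coset_sym:
  assumes "g \<in> carrier_mat n n" "h \<in> double_coset n g"
  shows "g \<in> double_coset n h"
proof -
  obtain u v where uv: "u \<in> unip_int n" "v \<in> unip_int n" "h = u * g * v"
    using assms by (auto simp: double_coset_def)
  obtain u' where u': "u' \<in> unip_int n" "u' * u = 1\<^sub>m n" using uv unip_int_inverse by metis
  obtain v' where v': "v' \<in> unip_int n" "v * v' = 1\<^sub>m n" using uv unip_int_inverse by metis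
  note [simp] = uv(1,2)[THEN unip_int_SL, unfolded SL_int_iff, THEN conjunct1]
    u'(1)[THEN unip_int_SL, unfolded SL_int_iff, THEN conjunct1]
    v'(1)[THEN unip_int_SL, unfolded SL_int_iff, THEN conjunct1] assms(1)
  have "u' * h * v' = (u' * u) * g * (v * v')"
    unfolding uv by (simp add: mult_square_carrier[where n = n] assoc_mult_mat[of _ n n _ n _ n])
  also have "\<dots> = g" using u' v' by (simp add: right_mult_one_mat[of _ n n] left_mult_one_mat[of _ n n])
  finally show ?thesis
    using u' v' unfolding double_coset_def by blast
qed

lemma double_coset_carrier:
  "g \<in> carrier_mat n n \<Longrightarrow> h \<in> double_coset n g \<Longrightarrow> h \<in> carrier_mat n n"
  by (auto simp: double_coset_def unip_int_iff intro!: mult_square_carrier dest!: unip_real_carrier)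

lemma double_coset_eq_iff:
  assumes "g \<in> carrier_mat n n" "h \<in> carrier_mat n n"
  shows "double_coset n g = double_coset n h \<longleftrightarrow> h \<in> double_coset n g"
  using assms double_coset_refl double_coset_trans double_coset_sym by blast

subsection \<open>Lower rows\<close>

text \<open>Carries the determinant of a lower left block: such a block will be an integral
  unipotent matrix times \<open>scale m d\<close> times a matrix of determinant 1.\<close>

definition scale :: "nat \<Rightarrow> real \<Rightarrow> real mat" where
  "scale m x = mat_diag m (\<lambda>i. if i = 0 then x else 1)"

lemma scale_carrier [simp]: "scale m x \<in> carrier_mat m m"
  by (simp add: scale_def mat_diag_def)

lemma scale_dim [simp]: "dim_row (scale m x) = m" "dim_col (scale m x) = m"
  by (simp_all add: scale_def mat_diag_def)

lemma scale_mult_index: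
  "A \<in> carrier_mat m k \<Longrightarrow> i < m \<Longrightarrow> j < k \<Longrightarrow>
    (scale m x * A) $$ (i, j) = (if i = 0 then x else 1) * A $$ (i, j)"
  by (simp add: scale_def mat_diag_mult_left)

lemma mult_scale_index:
  "A \<in> carrier_mat k m \<Longrightarrow> i < k \<Longrightarrow> j < m \<Longrightarrow>
    (A * scale m x) $$ (i, j) = A $$ (i, j) * (if j = 0 then x else 1)"
  by (simp add: scale_def mat_diag_mult_right)

lemma scale_inverse: "x \<noteq> 0 \<Longrightarrow> scale m x * scale m (1 / x) = 1\<^sub>m m"
  "x \<noteq> 0 \<Longrightarrow> scale m (1 / x) * scale m x = 1\<^sub>m m"
  unfolding scale_def mat_diag_diag by (auto simp: mat_diag_def one_mat_def)

text \<open>The product of \<open>h\<close> with the inverse of \<open>g\<close> agrees with the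
  identity below its first row, so it is upper triangular with diagonal
  \<open>det h, 1, ..., 1\<close>.\<close>

lemma same_lower_rows:
  assumes g: "g \<in> SL_int n" and h: "h \<in> carrier_mat n n" "int_mat h" and n: "n > 0"
    and eq: "\<And>i j. 0 < i \<Longrightarrow> i < n \<Longrightarrow> j < n \<Longrightarrow> h $$ (i, j) = g $$ (i, j)"
  obtains u where "u \<in> unip_int n" "h = u * (scale n (det h) * g)"
proof -
  obtain g' where g': "g' \<in> SL_int n" "g * g' = 1\<^sub>m n" "g' * g = 1\<^sub>m n"
    using SL_int_inverse[OF g] by metis
  define q where "q = h * g'"
  have c: "g \<in> carrier_mat n n" "g' \<in> carrier_mat n n" "det g' = 1" "int_mat g'"
    using g g' by (auto simp: SL_int_iff)
  have q: "q \<in> carrier_mat n n" "int_mat q" "det q = det h"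
    unfolding q_def using h c by (auto intro!: int_mat_mult simp: mult_square_carrier det_mult[of _ n])
  have row: "q $$ (i, j) = (if i = j then 1 else 0)" if "0 < i" "i < n" "j < n" for i j
  proof -
    have "q $$ (i, j) = (\<Sum>k\<in>{0..<n}. h $$ (i, k) * g' $$ (k, j))"
      unfolding q_def using c h that by (auto simp: scalar_prod_def)
    also have "\<dots> = (\<Sum>k\<in>{0..<n}. g $$ (i, k) * g' $$ (k, j))"
      using eq that by (intro sum.cong) auto
    also have "\<dots> = (g * g') $$ (i, j)"
      using c that by (auto simp: scalar_prod_def)
    finally show ?thesis using g' that by simp
  qed
  have "diag_mat q = q $$ (0, 0) # replicate (n - 1) 1"
    using q n row by (intro nth_equalityI) (auto simp: diag_mat_def nth_Cons')
  moreover have "upper_triangular q"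
    using row q by (auto simp: upper_triangular_def)
  ultimately have q00: "q $$ (0, 0) = det h"
    using det_upper_triangular[of q n] q by simp
  \<comment> \<open>\<open>u\<close> is \<open>q\<close> with its corner replaced by 1. Multiplying
    by \<open>scale n (det h)\<close> on the right rescales column 0 only, where the corner is the
    one nonzero entry, and so restores \<open>q\<close>.\<close>
  define u where "u = mat n n (\<lambda>(i, j). if i = j then 1 else q $$ (i, j))"
  have "u \<in> unip_int n"
    using q row unfolding unip_int_iff unip_real_iff by (auto simp: u_def int_mat_def)
  moreover have "h = u * (scale n (det h) * g)"
  proof -
    have uc: "u \<in> carrier_mat n n" by (simp add: u_def)
    have "u * scale n (det h) = q"
      using mult_scale_index[OF uc, of _ _ "det h"] q q00 row uc
      by (intro eq_matI) (auto simp: u_def)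
    then have "u * (scale n (det h) * g) = q * g"
      using uc c by (simp flip: assoc_mult_mat[of u n n _ n g n])
    also have "\<dots> = h"
      unfolding q_def using c h g' by (simp add: assoc_mult_mat[of h n n g' n g n])
    finally show ?thesis by simp
  qed
  ultimately show ?thesis using that by blast
qed

lemma same_lower_rows_SL:
  assumes g: "g \<in> SL_int n" and h: "h \<in> SL_int n" and n: "n > 0"
    and eq: "\<And>i j. 0 < i \<Longrightarrow> i < n \<Longrightarrow> j < n \<Longrightarrow> h $$ (i, j) = g $$ (i, j)"
  obtains u where "u \<in> unip_int n" "h = u * g"
proof -
  have "scale n 1 = 1\<^sub>m n" by (auto simp: scale_def mat_diag_def one_mat_def)
  then have "scale n (det h) * g = g"
    using g h by (auto simp: SL_int_iff)
  then show ?thesis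
    using same_lower_rows[OF g _ _ n eq] h that unfolding SL_int_iff by metis
qed

lemma block_triangular_mult:
  fixes u :: "real mat"
  assumes "T \<in> carrier_mat 1 m" "t \<in> carrier_mat 1 1" "G \<in> carrier_mat m m" "z \<in> carrier_mat m 1"
    and "u \<in> carrier_mat m m"
  shows "r \<in> carrier_mat 1 m \<Longrightarrow> four_block_mat (1\<^sub>m 1) r (0\<^sub>m m 1) u * four_block_mat T t G z
      = four_block_mat (T + r * G) (t + r * z) (u * G) (u * z)"
    and "c \<in> carrier_mat m 1 \<Longrightarrow> four_block_mat T t G z * four_block_mat u c (0\<^sub>m 1 m) (1\<^sub>m 1)
      = four_block_mat (T * u) (T * c + t) (G * u) (G * c + z)"
  using assms
  by (subst mult_four_block_mat[where ?nr1.0 = 1 and ?n1.0 = 1 and ?n2.0 = m and ?nr2.0 = m and ?nc1.0 = m and ?nc2.0 = 1],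
      auto)[] (use assms in \<open>subst mult_four_block_mat[where ?nr1.0 = 1 and ?n1.0 = m and ?n2.0 = 1
      and ?nr2.0 = m and ?nc1.0 = m and ?nc2.0 = 1], auto\<close>)

text \<open>In \<open>SL_int\<close> the lower rows determine the matrix up to a left unipotent
  factor, so only the two lower blocks have to be matched: \<open>u\<close> acts on the lower rows,
  \<open>v\<close> and \<open>a\<close> act on the columns.\<close>

lemma double_coset_lower_blocks:
  assumes H: "four_block_mat T1 t1 A1 z1 \<in> SL_int (Suc m)" "four_block_mat T2 t2 A2 z2 \<in> SL_int (Suc m)"
    and T: "T1 \<in> carrier_mat 1 m" "T2 \<in> carrier_mat 1 m" "t1 \<in> carrier_mat 1 1" "t2 \<in> carrier_mat 1 1"
    and A: "A1 \<in> carrier_mat m m" "A2 \<in> carrier_mat m m" "z1 \<in> carrier_mat m 1" "z2 \<in> carrier_mat m 1"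
    and uv: "u \<in> unip_int m" "v \<in> unip_int m" and a: "a \<in> carrier_mat m 1" "int_mat a"
    and eq: "A2 = u * A1 * v" "z2 = u * (z1 + A1 * a)"
  shows "four_block_mat T2 t2 A2 z2 \<in> double_coset (Suc m) (four_block_mat T1 t1 A1 z1)"
proof -
  let ?u = "four_block_mat (1\<^sub>m 1) (0\<^sub>m 1 m) (0\<^sub>m m 1) u" and ?v = "four_block_mat v a (0\<^sub>m 1 m) (1\<^sub>m 1)"
  let ?H1 = "four_block_mat T1 t1 A1 z1" and ?H2 = "four_block_mat T2 t2 A2 z2"
  have uv': "u \<in> carrier_mat m m" "v \<in> carrier_mat m m"
    using uv by (auto simp: unip_int_iff unip_real_carrier)
  have z: "int_mat (0\<^sub>m k l)" for k l by (simp add: int_mat_def)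
  have U: "?u \<in> unip_int (Suc m)" and V: "?v \<in> unip_int (Suc m)"
    using uv a uv' z unip_real_four_block_left[of u m "0\<^sub>m 1 m"] unip_real_four_block_right[of v m a]
    by (auto simp: unip_int_iff intro!: int_mat_four_block)
  have c: "?u \<in> carrier_mat (Suc m) (Suc m)" "?v \<in> carrier_mat (Suc m) (Suc m)"
    "?H1 \<in> carrier_mat (Suc m) (Suc m)"
    using U V H(1) by (auto simp: unip_int_iff unip_real_carrier SL_int_iff)
  let ?K = "?u * ?H1 * ?v"
  have "?u * ?H1 = four_block_mat T1 t1 (u * A1) (u * z1)"
    using block_triangular_mult(1)[OF T(1,3) A(1,3) uv'(1), of "0\<^sub>m 1 m"] T A by simp
  also have "\<dots> * ?v = four_block_mat (T1 * v) (T1 * a + t1) (u * A1 * v) (u * A1 * a + u * z1)"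
    using A uv' a
    by (intro block_triangular_mult(2)[OF T(1,3) _ _ uv'(2)]) (auto intro: mult_carrier_mat[of _ m m])
  also have "u * A1 * a + u * z1 = z2"
    unfolding eq using A uv' a
    by (simp add: mult_add_distrib_mat[of u m m] comm_add_mat[of _ m 1] mult_carrier_mat[of _ m m])
  finally have K: "?K = four_block_mat (T1 * v) (T1 * a + t1) A2 z2"
    by (simp add: eq)
  have "?K \<in> SL_int (Suc m)"
    by (rule SL_int_mult[OF SL_int_mult[OF unip_int_SL[OF U] H(1)] unip_int_SL[OF V]])
  moreover have "?H2 $$ (i, j) = ?K $$ (i, j)" if "0 < i" "i < Suc m" "j < Suc m" for i j
    unfolding K using that T A uv' a by auto
  ultimately obtain w where w: "w \<in> unip_int (Suc m)" "?H2 = w * ?K"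
    using same_lower_rows_SL[of ?K "Suc m" ?H2] H(2) by auto
  have wc: "w \<in> carrier_mat (Suc m) (Suc m)" using w by (simp add: unip_int_iff unip_real_carrier)
  have "?H2 = (w * ?u) * ?H1 * ?v"
    unfolding w(2) using wc c
    by (simp only: assoc_mult_mat[where ?n\<^sub>1 = "Suc m" and ?n\<^sub>2 = "Suc m" and ?n\<^sub>3 = "Suc m" and ?n\<^sub>4 = "Suc m"]
        mult_square_carrier)
  then show ?thesis
    unfolding double_coset_def using unip_int_mult[OF w(1) U] V by blast
qed

section \<open>Conjugation by \<open>scale\<close> and blocks of Bruhat products\<close>

lemma int_mat_scale: "x \<in> \<int> \<Longrightarrow> int_mat (scale m x)"
  by (auto simp: int_mat_def scale_def mat_diag_def)

lemma conj_scale_index: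
  assumes "u \<in> carrier_mat m m" "i < m" "j < m"
  shows "(scale m x * u * scale m y) $$ (i, j)
    = (if i = 0 then x else 1) * u $$ (i, j) * (if j = 0 then y else 1)"
proof -
  have "scale m x * u \<in> carrier_mat m m"
    using assms by (auto intro: mult_carrier_mat[of _ m m])
  then show ?thesis
    using assms mult_scale_index[of "scale m x * u" m m i j y] scale_mult_index[of u m m i j x] by simp
qed

text \<open>The factor \<open>1 / x\<close> reaches only column 0, where the single nonzero entry of
  \<open>u\<close> is the corner, and there \<open>x\<close> compensates it. The rest of the first
  row is multiplied by \<open>x\<close>.\<close>

lemma conj_scale_unip:
  assumes "u \<in> unip_real m" "x \<noteq> 0"
  shows "scale m x * u * scale m (1 / x) \<in> unip_real m"
    "x \<in> \<int> \<Longrightarrow> int_mat u \<Longrightarrow> int_mat (scale m x * u * scale m (1 / x))"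
proof -
  note c = unip_real_carrier[OF assms(1)]
  note ix = conj_scale_index[OF c, of _ _ x "1 / x"]
  have K: "scale m x * u * scale m (1 / x) \<in> carrier_mat m m"
    using c by (auto intro!: mult_carrier_mat[of _ m m])
  then show "scale m x * u * scale m (1 / x) \<in> unip_real m"
    using assms ix unfolding unip_real_iff by auto
  assume "x \<in> \<int>" "int_mat u"
  then have "(scale m x * u * scale m (1 / x)) $$ (i, j) \<in> \<int>" if "i < m" "j < m" for i j
    using ix[OF that] that assms c by (cases "j \<le> i") (auto simp: unip_real_iff int_mat_def)
  then show "int_mat (scale m x * u * scale m (1 / x))"
    using K by (simp add: int_mat_def)
qed

definition col0 :: "nat \<Rightarrow> real \<Rightarrow> real mat" where
  "col0 m x = mat m 1 (\<lambda>(i, _). if i = 0 then x else 0)"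

lemma col0_carrier [simp]: "col0 m x \<in> carrier_mat m 1" "col0 m x \<in> carrier_mat m (Suc 0)"
  by (simp_all add: col0_def)

lemma mult_col0:
  assumes "A \<in> carrier_mat m m" "m > 0" "\<And>i. i < m \<Longrightarrow> A $$ (i, 0) = (if i = 0 then y else 0)"
  shows "A * col0 m x = col0 m (y * x)"
proof (rule eq_matI)
  fix i j assume "i < dim_row (col0 m (y * x))" "j < dim_col (col0 m (y * x))"
  then have ij: "i < m" "j = 0" by (auto simp: col0_def)
  have "(A * col0 m x) $$ (i, j) = (\<Sum>k\<in>{0..<m}. A $$ (i, k) * (if k = 0 then x else 0))"
    using assms ij by (simp add: scalar_prod_def col0_def)
  also have "\<dots> = (\<Sum>k\<in>{0..<m}. if k = 0 then A $$ (i, 0) * x else 0)"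
    by (intro sum.cong) auto
  also have "\<dots> = col0 m (y * x) $$ (i, j)"
    using assms ij by (simp add: col0_def)
  finally show "(A * col0 m x) $$ (i, j) = col0 m (y * x) $$ (i, j)" .
qed (use assms in \<open>auto simp: col0_def\<close>)

lemma unip_mult_col0: "u \<in> unip_real m \<Longrightarrow> m > 0 \<Longrightarrow> u * col0 m x = col0 m x"
  using mult_col0[of u m 1 x] by (auto simp: unip_real_iff)

lemma scale_mult_col0: "m > 0 \<Longrightarrow> scale m y * col0 m x = col0 m (y * x)"
  using mult_col0[of "scale m y" m y x] by (auto simp: scale_def mat_diag_def)

text \<open>For the top row of \<open>glue_b1\<close>, which is a multiple of the first row of a
  square block: its products are read off from those of that block.\<close>

lemma first_row_mult:
  fixes A B :: "real mat"
  assumes "A \<in> carrier_mat m k" "B \<in> carrier_mat k l" "m > 0"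
  shows "mat 1 k (\<lambda>(_, j). x * A $$ (0, j)) * B = mat 1 l (\<lambda>(_, j). x * (A * B) $$ (0, j))"
  using assms by (intro eq_matI) (auto simp: scalar_prod_def sum_distrib_left mult.assoc)

text \<open>The lower left block is again a Bruhat product with the same weights \<open>f\<close>,
  so the step can be iterated to reach smaller corner minors.\<close>

lemma lower_left_bruhat:
  assumes b: "b1 \<in> unip_real (Suc m)" "b2 \<in> unip_real (Suc m)"
  obtains u v T t z where "u \<in> unip_real m" "v \<in> unip_real m"
    "T \<in> carrier_mat 1 m" "t \<in> carrier_mat 1 1" "z \<in> carrier_mat m 1"
    "b1 * antidiag (Suc m) f * b2 = four_block_mat T t (u * antidiag m f * v) z"
proof -
  obtain r u where u: "r \<in> carrier_mat 1 m" "u \<in> unip_real m" "b1 = four_block_mat (1\<^sub>m 1) r (0\<^sub>m m 1) u"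
    using unip_real_split_left[OF b(1)] by metis
  obtain c v where v: "c \<in> carrier_mat m 1" "v \<in> unip_real m" "b2 = four_block_mat v c (0\<^sub>m 1 m) (1\<^sub>m 1)"
    using unip_real_split_right[OF b(2)] by metis
  define x where "x = mat 1 1 (\<lambda>_. (-1) ^ m * f m)"
  define W where "W = antidiag m f"
  have c: "u \<in> carrier_mat m m" "v \<in> carrier_mat m m" "W \<in> carrier_mat m m" "x \<in> carrier_mat 1 1"
    using u v by (auto simp: unip_real_carrier x_def W_def)
  then have p: "r * W \<in> carrier_mat 1 m" "u * W \<in> carrier_mat m m"
    using u(1) by (auto intro: mult_carrier_mat)
  have "b1 * antidiag (Suc m) f = four_block_mat (r * W) x (u * W) (0\<^sub>m m 1)"
    unfolding u(3) antidiag_Suc x_def[symmetric] W_def[symmetric]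
    using c u(1) p block_triangular_mult(1)[of "0\<^sub>m 1 m" m x W "0\<^sub>m m 1" u r] by simp
  then have "b1 * antidiag (Suc m) f * b2 = four_block_mat (r * W * v) (r * W * c + x) (u * W * v) (u * W * c)"
    unfolding v(3) using c v(1) p block_triangular_mult(2)[of "r * W" m x "u * W" "0\<^sub>m m 1" v c] by simp
  moreover have "r * W * v \<in> carrier_mat 1 m" "r * W * c + x \<in> carrier_mat 1 1" "u * W * c \<in> carrier_mat m 1"
    using c v(1) p by (auto intro: mult_carrier_mat)
  ultimately show ?thesis
    using that[OF u(2) v(2)] unfolding W_def by blast
qed

lemma four_block_lower_left_eq:
  assumes "four_block_mat A B C E = four_block_mat A' B' C' E'"
    and "A \<in> carrier_mat k m" "A' \<in> carrier_mat k m" "C \<in> carrier_mat l m" "C' \<in> carrier_mat l m"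
    and "E \<in> carrier_mat l p" "E' \<in> carrier_mat l p"
  shows "C = C'"
proof (rule eq_matI)
  fix i j assume "i < dim_row C'" "j < dim_col C'"
  then show "C $$ (i, j) = C' $$ (i, j)"
    using arg_cong[OF assms(1), of "\<lambda>X. X $$ (k + i, j)"] assms(2-) by auto
qed (use assms in auto)

lemma two_bruhat_index:
  fixes f :: "nat \<Rightarrow> real"
  assumes "b1 \<in> unip_real 2" "b2 \<in> unip_real 2"
  and g_def: "g = b1 * antidiag 2 f * b2"
  shows "g $$ (0, 0) = b1 $$ (0, 1) * f 0" "g $$ (1, 0) = f 0"
    "g $$ (1, 1) = f 0 * b2 $$ (0, 1)" "g $$ (0, 1) = b1 $$ (0, 1) * f 0 * b2 $$ (0, 1) - f 1"
proof -
  have c: "b1 \<in> carrier_mat 2 2" "b2 \<in> carrier_mat 2 2" using assms by (auto simp: unip_real_carrier)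
  have b: "b1 $$ (0, 0) = 1" "b1 $$ (1, 0) = 0" "b1 $$ (1, 1) = 1"
    "b2 $$ (0, 0) = 1" "b2 $$ (1, 0) = 0" "b2 $$ (1, 1) = 1"
    using assms by (auto simp: unip_real_iff)
  have ix: "g $$ (i, j) = (\<Sum>k\<in>{0..<2}. (b1 * antidiag 2 f) $$ (i, k) * b2 $$ (k, j))" if "i < 2" "j < 2" for i j
    unfolding g_def using c that by (simp add: scalar_prod_def)
  have ix': "g $$ (i, j) = (\<Sum>k\<in>{0..<2}. b1 $$ (i, 1 - k) * ((-1) ^ k * f k) * b2 $$ (k, j))" if "i < 2" "j < 2" for i j
    unfolding ix[OF that] using that antidiag_mult_right_index[OF c(1), of i _ f] by (intro sum.cong) auto
  show "g $$ (0, 0) = b1 $$ (0, 1) * f 0" "g $$ (1, 0) = f 0"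
    "g $$ (1, 1) = f 0 * b2 $$ (0, 1)" "g $$ (0, 1) = b1 $$ (0, 1) * f 0 * b2 $$ (0, 1) - f 1"
    using b by (auto simp: ix' numeral_2_eq_2)
qed

subsection \<open>Gluing along the lower left block\<close>

lemma C_set_two:
  assumes d: "d > 0" and g: "g \<in> C_set 2 (\<lambda>_. d)"
  shows "g \<in> carrier_mat 2 2" "\<And>i j. i < 2 \<Longrightarrow> j < 2 \<Longrightarrow> g $$ (i, j) \<in> \<int>"
    "g $$ (1, 0) = real d" "g $$ (0, 0) * g $$ (1, 1) = 1 + real d * g $$ (0, 1)"
    "mu 2 (\<lambda>_. d) g $$ (0, 1) = g $$ (0, 0) / real d"
    "mu' 2 (\<lambda>_. d) g $$ (0, 1) = g $$ (1, 1) / real d"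
    "mu' 2 (\<lambda>_. d) g \<in> unip_real 2"
proof -
  let ?f = "ratio 2 (\<lambda>_. d)"
  have f: "?f 0 = d" "?f 1 = 1 / d" by (auto simp: ratio_def ext_def)
  have D: "pos_tuple 2 (\<lambda>_. d)" using d by (simp add: pos_tuple_def)
  obtain b1 b2 where b: "b1 \<in> unip_real 2" "b2 \<in> unip_real 2" "g = b1 * antidiag 2 ?f * b2"
    using g by (auto simp: C_set_iff)
  note mu = mu_bruhat[OF D b] and ix = two_bruhat_index[OF b, unfolded f]
  show "g \<in> carrier_mat 2 2" "\<And>i j. i < 2 \<Longrightarrow> j < 2 \<Longrightarrow> g $$ (i, j) \<in> \<int>"
    using g by (auto simp: C_set_iff SL_int_def)
  show "g $$ (1, 0) = real d" by (rule ix(2))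
  show "g $$ (0, 0) * g $$ (1, 1) = 1 + real d * g $$ (0, 1)"
    unfolding ix using d by (simp add: field_simps)
  show "mu 2 (\<lambda>_. d) g $$ (0, 1) = g $$ (0, 0) / real d" "mu' 2 (\<lambda>_. d) g $$ (0, 1) = g $$ (1, 1) / real d"
    unfolding mu ix using d by simp_all
  show "mu' 2 (\<lambda>_. d) g \<in> unip_real 2" using mu b by simp
qed

text \<open>The superdiagonal entries of the Bruhat factors are forced to be \<open>p / d\<close>
  and \<open>z / d\<close>; the upper right entry is then \<open>(p * z - 1) / d\<close>.\<close>

lemma C_set_two_exists:
  assumes d: "d > 0" and "p \<in> \<int>" "z \<in> \<int>" "(p * z - 1) / real d \<in> \<int>"
  obtains g where "g \<in> C_set 2 (\<lambda>_. d)" "g $$ (0, 0) = p" "g $$ (1, 1) = z"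
proof -
  let ?f = "ratio 2 (\<lambda>_. d)"
  have f: "?f 0 = d" "?f 1 = 1 / d" by (auto simp: ratio_def ext_def)
  have D: "pos_tuple 2 (\<lambda>_. d)" using d by (simp add: pos_tuple_def)
  define U where "U x = mat 2 2 (\<lambda>(i, j). if i = j then 1 else if i < j then x else (0::real))" for x
  have U: "U x \<in> unip_real 2" "U x $$ (0, 1) = x" for x by (auto simp: U_def unip_real_iff)
  define g where "g = U (p / d) * antidiag 2 ?f * U (z / d)"
  note ix = two_bruhat_index[OF U(1) U(1) g_def, unfolded f U(2)]
  have ix': "g $$ (0, 0) = p" "g $$ (1, 1) = z" "g $$ (0, 1) = (p * z - 1) / d"
    using d unfolding ix by (auto simp: field_simps)
  have "g \<in> carrier_mat 2 2"
    using U by (auto simp: g_def unip_real_carrier intro!: mult_square_carrier)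
  then have "int_mat g"
    using assms ix' ix(2) by (auto simp: int_mat_def less_2_cases_iff)
  then have "g \<in> C_set 2 (\<lambda>_. d)"
    by (intro bruhat_SL[OF D U(1) U(1) g_def]) auto
  then show ?thesis using that ix' by blast
qed

text \<open>The lower rows start with \<open>d\<close>, so adding \<open>t\<close> times the first
  column of \<open>g\<close> to the second, a right translation, makes them equal; what remains is a
  left translation.\<close>

lemma double_coset_two:
  assumes d: "d > 0" and g: "g \<in> C_set 2 (\<lambda>_. d)" "h \<in> C_set 2 (\<lambda>_. d)"
    and t: "t \<in> \<int>" "h $$ (1, 1) = g $$ (1, 1) + t * real d"
  shows "h \<in> double_coset 2 g"
proof -
  note G = C_set_two[OF d g(1)] and H = C_set_two[OF d g(2)]
  define v where "v = mat 2 2 (\<lambda>(i, j). if i = j then 1 else if i < j then t else (0::real))"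
  have v: "v \<in> unip_int 2" using t by (auto simp: v_def unip_int_iff unip_real_iff int_mat_def)
  have vc: "v \<in> carrier_mat 2 2" by (simp add: v_def)
  have SL: "g \<in> SL_int 2" "h \<in> SL_int 2" "v \<in> SL_int 2" using g v by (auto simp: C_set_iff unip_int_SL)
  have row: "(g * v) $$ (1, j) = h $$ (1, j)" if "j < 2" for j
  proof -
    have "(g * v) $$ (1, j) = (\<Sum>k\<in>{0..<2}. g $$ (1, k) * v $$ (k, j))"
      using G(1) vc that by (simp add: scalar_prod_def)
    then show ?thesis
      using that G(3) H(3) t(2) by (auto simp: numeral_2_eq_2 v_def less_Suc_eq)
  qed
  obtain u where u: "u \<in> unip_int 2" "h = u * (g * v)"
  proof (rule same_lower_rows_SL[of "g * v" 2 h])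
    show "g * v \<in> SL_int 2" using SL by (intro SL_int_mult)
    show "h $$ (i, j) = (g * v) $$ (i, j)" if "0 < i" "i < 2" "j < 2" for i j
      using row[of j] that by (cases "i = 1") auto
  qed (use SL in auto)
  have "u \<in> carrier_mat 2 2" using u by (simp add: unip_int_iff unip_real_carrier)
  then have "h = u * g * v"
    using u(2) G(1) vc by (simp add: assoc_mult_mat[of u 2 2 g 2 v 2])
  then show ?thesis using u v unfolding double_coset_def by blast
qed

text \<open>The superdiagonal entry of \<open>mu'\<close> is the lower right entry divided by
  \<open>d\<close>, and right translation shifts it by an integer.\<close>

lemma double_coset_two_mod:
  assumes d: "d > 0" and g: "g \<in> C_set 2 (\<lambda>_. d)" and h: "h \<in> double_coset 2 g"
  obtains t where "t \<in> \<int>" "h $$ (1, 1) = g $$ (1, 1) + t * real d"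
proof -
  have D: "pos_tuple 2 (\<lambda>_. d)" using d by (simp add: pos_tuple_def)
  obtain u v where uv: "u \<in> unip_int 2" "v \<in> unip_int 2" "h = u * g * v"
    using h by (auto simp: double_coset_def)
  note tr = C_set_translate[OF D g uv(1,2), folded uv(3)]
  note G = C_set_two[OF d g] and H = C_set_two[OF d tr(1)]
  have "mu' 2 (\<lambda>_. d) h $$ (0, 1) = mu' 2 (\<lambda>_. d) g $$ (0, 1) + v $$ (0, 1)"
    unfolding tr(3) using unip_real_superdiag_mult[OF G(7), of v 0] uv by (simp add: unip_int_iff)
  then have "h $$ (1, 1) = g $$ (1, 1) + v $$ (0, 1) * real d"
    unfolding G(6) H(6) using d by (simp add: field_simps)
  moreover have "v $$ (0, 1) \<in> \<int>" using uv(2) by (auto simp: unip_int_def)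
  ultimately show ?thesis using that by blast
qed

text \<open>\<open>Suc m\<close> is the larger size. Coprimality enters as an inverse
  \<open>b\<close> of \<open>D (m - 1)\<close> modulo \<open>D m\<close>, with quotient
  \<open>k\<close>.\<close>

locale coprime_split =
  fixes m :: nat and D :: "nat \<Rightarrow> nat" and b k :: int
  assumes m2: "2 \<le> m"
    and pos: "pos_tuple (Suc m) D"
    and inverse: "int (D (m - 1)) * b = 1 + int (D m) * k"
begin

abbreviation "d \<equiv> real (D m)"
abbreviation "a \<equiv> real (D (m - 1))"
abbreviation "s \<equiv> (-1 :: real) ^ (m + 1)"

lemma d_pos [simp]: "D m > 0" and a_pos [simp]: "D (m - Suc 0) > 0"
  using pos m2 by (auto simp: pos_tuple_def)

lemma d_nonzero [simp]: "D m \<noteq> 0" and a_nonzero [simp]: "D (m - Suc 0) \<noteq> 0"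
  using d_pos a_pos by simp_all

lemma pos_m: "pos_tuple m D"
  using pos by (auto simp: pos_tuple_def)

lemma ab: "a * of_int b = 1 + d * of_int k"
  using inverse by (metis of_int_1 of_int_add of_int_mult of_int_of_nat_eq)

text \<open>
  This is \<open>diag(h', 1, \<dots>, 1) P diag(g, 1)\<close>, where \<open>h'\<close> has the diagonal entries \<open>a h\<^sub>0\<^sub>0\<close> and
  \<open>b h\<^sub>1\<^sub>1\<close>. The twist by \<open>a\<close> and its inverse \<open>b\<close> modulo \<open>d\<close> moves the factor \<open>D\<^sub>n\<^sub>-\<^sub>2\<close>,
  which without it would multiply \<open>N\<^sub>n\<^sub>-\<^sub>1\<close>, to \<open>M\<^sub>n\<^sub>-\<^sub>1\<close>.
\<close>

definition glue :: "real mat \<Rightarrow> real mat \<Rightarrow> real mat" where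
  "glue g h = four_block_mat
     (mat 1 m (\<lambda>(_, j). a * h $$ (0, 0) * g $$ (0, j)))
     (mat 1 1 (\<lambda>_. s * (a * of_int b * h $$ (0, 0) * h $$ (1, 1) - 1) / d))
     (scale m d * g)
     (col0 m (s * of_int b * h $$ (1, 1)))"

section \<open>Bruhat factors of a glued matrix\<close>

lemma antidiag_ratio_Suc: "antidiag m (ratio (Suc m) D) = scale m d * antidiag m (ratio m D)"
proof (rule eq_matI)
  fix i j assume "i < dim_row (scale m d * antidiag m (ratio m D))"
    "j < dim_col (scale m d * antidiag m (ratio m D))"
  then have ij: "i < m" "j < m" by auto
  \<comment> \<open>For \<open>j < m\<close> the two ratios differ only at \<open>j = m - 1\<close>,
    since \<open>ext (Suc m) D m\<close> is \<open>D m\<close> while \<open>ext m D m\<close> is 1;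
    that column has its nonzero entry in row 0.\<close>
  show "antidiag m (ratio (Suc m) D) $$ (i, j) = (scale m d * antidiag m (ratio m D)) $$ (i, j)"
    unfolding scale_mult_index[OF antidiag_carrier ij]
    using ij m2 by (auto simp: antidiag_def ratio_def ext_def)
qed auto

lemma antidiag_blocks:
  "antidiag (Suc m) (ratio (Suc m) D) =
     four_block_mat (0\<^sub>m 1 m) (mat 1 1 (\<lambda>_. (-1) ^ m / d)) (scale m d * antidiag m (ratio m D)) (0\<^sub>m m 1)"
  using m2 unfolding antidiag_Suc antidiag_ratio_Suc by (simp add: ratio_def ext_def)

text \<open>The last column of \<open>antidiag m (ratio m D)\<close> has weight
  \<open>1 / a\<close>, which cancels \<open>a\<close>, and its sign \<open>(-1) ^ (m - 1)\<close>
  equals \<open>s\<close>.\<close>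

lemma antidiag_last:
  "scale m d * antidiag m (ratio m D) * mat m 1 (\<lambda>(i, _). if i = m - 1 then y * a else 0) = col0 m (s * d * y)"
proof (rule eq_matI)
  fix i j assume "i < dim_row (col0 m (s * d * y))" "j < dim_col (col0 m (s * d * y))"
  then have ij: "i < m" "j < 1" "j = 0" by (auto simp: col0_def)
  let ?c = "mat m 1 (\<lambda>(i, _). if i = m - 1 then y * a else 0) :: real mat"
  have c: "?c \<in> carrier_mat m 1" by simp
  have AC: "antidiag m (ratio m D) * ?c \<in> carrier_mat m 1"
    using c by (intro mult_carrier_mat[of _ m m]) auto
  have "scale m d * antidiag m (ratio m D) * ?c = scale m d * (antidiag m (ratio m D) * ?c)"
    by (rule assoc_mult_mat[of _ m m _ m _ 1]) auto
  moreover have "(antidiag m (ratio m D) * ?c) $$ (i, j) = (if i = 0 then s * y else 0)"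
    unfolding antidiag_mult_left_index[OF c ij(1,2)]
    using ij m2 power_add[of "-1::real" "m - 1" 2] by (auto simp: ratio_def ext_def)
  ultimately show "(scale m d * antidiag m (ratio m D) * ?c) $$ (i, j) = col0 m (s * d * y) $$ (i, j)"
    using scale_mult_index[OF AC ij(1,2)] ij by (auto simp: col0_def)
qed (auto simp: col0_def)

text \<open>The top row is a multiple of the first row of the lower right block, which makes the top
  left block of \<open>glue\<close> a multiple of the first row of \<open>g\<close>. For unipotent
  \<open>b1\<close> the first superdiagonal entry is \<open>a * h $$ (0, 0) / d\<close>.\<close>

definition glue_b1 :: "real mat \<Rightarrow> real mat \<Rightarrow> real mat" where
  "glue_b1 b1 h = four_block_mat (1\<^sub>m 1)
     (mat 1 m (\<lambda>(_, j). a * h $$ (0, 0) / d * (scale m d * b1 * scale m (1 / d)) $$ (0, j)))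
     (0\<^sub>m m 1) (scale m d * b1 * scale m (1 / d))"

text \<open>As \<open>a * of_int b\<close> is 1 modulo \<open>d\<close>, the nonzero entry above the
  corner is \<open>h $$ (1, 1) / d\<close> up to an integer when \<open>h\<close> is
  integral.\<close>

definition glue_b2 :: "real mat \<Rightarrow> real mat \<Rightarrow> real mat" where
  "glue_b2 b2 h = four_block_mat b2
     (mat m 1 (\<lambda>(i, _). if i = m - 1 then of_int b * h $$ (1, 1) / d * a else 0)) (0\<^sub>m 1 m) (1\<^sub>m 1)"

lemma glue_b1_unip: "b1 \<in> unip_real m \<Longrightarrow> glue_b1 b1 h \<in> unip_real (Suc m)"
  unfolding glue_b1_def by (intro unip_real_four_block_left conj_scale_unip) auto

lemma glue_b2_unip: "b2 \<in> unip_real m \<Longrightarrow> glue_b2 b2 h \<in> unip_real (Suc m)"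
  unfolding glue_b2_def by (intro unip_real_four_block_right) auto

lemma glue_bruhat:
  assumes b: "b1 \<in> unip_real m" "b2 \<in> unip_real m" and g: "g = b1 * antidiag m (ratio m D) * b2"
  shows "glue g h = glue_b1 b1 h * antidiag (Suc m) (ratio (Suc m) D) * glue_b2 b2 h"
proof -
  define K where "K = scale m d * b1 * scale m (1 / d)"
  define W where "W = scale m d * antidiag m (ratio m D)"
  define p where "p = a * h $$ (0, 0) / d"
  define y where "y = of_int b * h $$ (1, 1) / d"
  define r where "r = mat 1 m (\<lambda>(_, j). p * K $$ (0, j))"
  define c where "c = (mat m 1 (\<lambda>(i, _). if i = m - 1 then y * a else 0) :: real mat)"
  define x where "x = (mat 1 1 (\<lambda>_. (-1) ^ m / d) :: real mat)"
  have m: "m > 0" using m2 by simp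
  note bc = b[THEN unip_real_carrier]
  have K: "K \<in> unip_real m" unfolding K_def using b by (intro conj_scale_unip) auto
  have W: "W \<in> carrier_mat m m" by (simp add: W_def mult_square_carrier)
  have Kc: "K \<in> carrier_mat m m" and rc: "r \<in> carrier_mat 1 m" and cc: "c \<in> carrier_mat m 1"
    and xc: "x \<in> carrier_mat 1 1"
    using K by (auto simp: unip_real_carrier r_def c_def x_def)
  have Wc: "W * c = col0 m (s * d * y)"
    unfolding W_def c_def by (rule antidiag_last)
  \<comment> \<open>The inner factor \<open>scale m (1 / d)\<close> of \<open>K\<close> cancels the
    factor \<open>scale m d\<close> of \<open>W\<close>.\<close>
  have KW: "K * W = scale m d * (b1 * antidiag m (ratio m D))"
    using bc scale_inverse(2)[of d m] unfolding K_def W_def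
    by (simp add: mult_square_carrier[where n = m] assoc_mult_mat[of _ m m _ m _ m] mult_inverse_cancel[of _ m _ _ m])
  have KWb: "K * (W * b2) = scale m d * g"
    unfolding g using KW bc Kc W
    by (simp add: mult_square_carrier[where n = m] assoc_mult_mat[of _ m m _ m _ m] flip: assoc_mult_mat[of K m m W m b2 m])
  have Wb: "W * b2 \<in> carrier_mat m m" using W bc by (simp add: mult_square_carrier)
  have "antidiag (Suc m) (ratio (Suc m) D) * glue_b2 b2 h = four_block_mat (0\<^sub>m 1 m) x (W * b2) (W * c)"
    unfolding antidiag_blocks glue_b2_def W_def[symmetric] x_def[symmetric] y_def[symmetric] c_def[symmetric]
    using W xc cc bc block_triangular_mult(2)[of "0\<^sub>m 1 m" m x W "0\<^sub>m m 1" b2 c] by simp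
  then have "glue_b1 b1 h * (antidiag (Suc m) (ratio (Suc m) D) * glue_b2 b2 h)
    = four_block_mat (r * (W * b2)) (x + r * (W * c)) (K * (W * b2)) (K * (W * c))"
    unfolding glue_b1_def K_def[symmetric] p_def[symmetric] r_def[symmetric]
    using W xc cc bc Kc rc Wb block_triangular_mult(1)[of "0\<^sub>m 1 m" m x "W * b2" "W * c" K r] Wc by simp
  also have "K * (W * c) = col0 m (s * of_int b * h $$ (1, 1))"
    unfolding Wc unip_mult_col0[OF K m] by (simp add: y_def mult.assoc)
  also have "K * (W * b2) = scale m d * g" by (rule KWb)
  also have "r * (W * b2) = mat 1 m (\<lambda>(_, j). a * h $$ (0, 0) * g $$ (0, j))"
  proof -
    have gc: "g \<in> carrier_mat m m" using g bc by (simp add: mult_square_carrier)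
    show ?thesis
      unfolding r_def first_row_mult[OF Kc Wb m] KWb
      using m scale_mult_index[OF gc, of 0 _ d] by (intro eq_matI) (auto simp: p_def)
  qed
  \<comment> \<open>The sign \<open>(-1) ^ m\<close> in \<open>x\<close> is \<open>- s\<close>,
    whence the \<open>- 1\<close> in the corner of \<open>glue\<close>.\<close>
  also have "x + r * (W * c) = mat 1 1 (\<lambda>_. s * (a * of_int b * h $$ (0, 0) * h $$ (1, 1) - 1) / d)"
  proof -
    have "r * (W * c) = mat 1 1 (\<lambda>(_, j). p * (K * (W * c)) $$ (0, j))"
      unfolding r_def using Wc by (intro first_row_mult[OF Kc _ m]) simp
    also have "K * (W * c) = col0 m (s * d * y)"
      unfolding Wc by (rule unip_mult_col0[OF K m])
    finally show ?thesis
      using m by (intro eq_matI) (auto simp: x_def p_def y_def col0_def field_simps)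
  qed
  finally show ?thesis
    unfolding glue_def
    using glue_b1_unip[OF b(1), of h] glue_b2_unip[OF b(2), of h]
    by (simp add: unip_real_carrier assoc_mult_mat[of _ "Suc m" "Suc m" _ "Suc m" _ "Suc m"])
qed

end

section \<open>Integrality and characters of glued matrices\<close>

lemma C_set_decomp:
  assumes "pos_tuple n D" "g \<in> C_set n D"
  shows "mu n D g \<in> unip_real n" "mu' n D g \<in> unip_real n"
    "g = mu n D g * antidiag n (ratio n D) * mu' n D g"
proof -
  obtain b1 b2 where b: "b1 \<in> unip_real n" "b2 \<in> unip_real n" "g = b1 * antidiag n (ratio n D) * b2"
    using assms(2) by (auto simp: C_set_iff)
  note mu = mu_bruhat[OF assms(1) b]
  show "mu n D g \<in> unip_real n" "mu' n D g \<in> unip_real n"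
    "g = mu n D g * antidiag n (ratio n D) * mu' n D g"
    unfolding mu using b by auto
qed

context coprime_split
begin

lemma glue_C_set:
  assumes g: "g \<in> C_set m D" and h: "h \<in> C_set 2 (\<lambda>_. D m)"
  shows "glue g h \<in> C_set (Suc m) D"
    "mu (Suc m) D (glue g h) = glue_b1 (mu m D g) h"
    "mu' (Suc m) D (glue g h) = glue_b2 (mu' m D g) h"
proof -
  note b = C_set_decomp[OF pos_m g]
  note gb = glue_b1_unip[OF b(1), of h] glue_b2_unip[OF b(2), of h] glue_bruhat[OF b, of h]
  note H = C_set_two[OF d_pos h]
  have gi: "g \<in> carrier_mat m m" "int_mat g" using g by (auto simp: C_set_iff SL_int_iff)
  have hi: "h $$ (0, 0) \<in> \<int>" "h $$ (1, 1) \<in> \<int>" "h $$ (0, 1) \<in> \<int>" using H(2) by auto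
  \<comment> \<open>Both \<open>a * of_int b\<close> and \<open>h $$ (0, 0) * h $$ (1, 1)\<close>
    are 1 modulo \<open>d\<close>, so the upper right corner of \<open>glue\<close> is an
    integer.\<close>
  have "(a * of_int b * h $$ (0, 0) * h $$ (1, 1) - 1) / d
    = ((1 + d * of_int k) * (1 + d * h $$ (0, 1)) - 1) / d"
    unfolding ab[symmetric] H(4)[symmetric] by (simp add: mult.assoc)
  also have "\<dots> = of_int k + h $$ (0, 1) + d * of_int k * h $$ (0, 1)"
    by (simp add: field_simps)
  finally have q: "(a * of_int b * h $$ (0, 0) * h $$ (1, 1) - 1) / d \<in> \<int>"
    using hi by simp
  have s: "s \<in> \<int>" by simp
  have "int_mat (glue g h)"
    unfolding glue_def
  proof (rule int_mat_four_block)
    show "int_mat (mat 1 m (\<lambda>(_, j). a * h $$ (0, 0) * g $$ (0, j)))"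
      using gi hi m2 by (auto simp: int_mat_def)
    show "int_mat (mat 1 1 (\<lambda>_. s * (a * of_int b * h $$ (0, 0) * h $$ (1, 1) - 1) / d))"
      using Ints_mult[OF s q] by (simp add: int_mat_def)
    show "int_mat (scale m d * g)"
      using gi by (intro int_mat_mult int_mat_scale) auto
    show "int_mat (col0 m (s * of_int b * h $$ (1, 1)))"
      using hi by (auto simp: int_mat_def col0_def)
  qed (use gi in \<open>auto simp: col0_def\<close>)
  then show "glue g h \<in> C_set (Suc m) D"
    by (intro bruhat_SL[OF pos gb]) auto
  show "mu (Suc m) D (glue g h) = glue_b1 (mu m D g) h"
    "mu' (Suc m) D (glue g h) = glue_b2 (mu' m D g) h"
    using mu_bruhat[OF pos gb] by auto
qed

text \<open>The superdiagonal of the left factor is that of \<open>mu m D g\<close> with its first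
  entry multiplied by \<open>d\<close>, preceded by an entry from \<open>h\<close>; that of the
  right factor is that of \<open>mu' m D g\<close> followed by an entry from \<open>h\<close>. So
  both characters split.\<close>

lemma phase_glue:
  assumes g: "g \<in> C_set m D" and h: "h \<in> C_set 2 (\<lambda>_. D m)"
  shows "phase (Suc m) M N D (glue g h) =
    phase m (M(m - 1 := int (D m) * M (m - 1))) N D g *
    phase 2 (\<lambda>_. int (D (m - 1)) * M m) (\<lambda>_. N m) (\<lambda>_. D m) h"
proof -
  let ?M = "M(m - 1 := int (D m) * M (m - 1))"
  define b1 where "b1 = mu m D g"
  define b2 where "b2 = mu' m D g"
  have b: "b1 \<in> unip_real m" "b2 \<in> unip_real m"
    using C_set_decomp[OF pos_m g] by (auto simp: b1_def b2_def)
  note H = C_set_two[OF d_pos h]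
  define K where "K = scale m d * b1 * scale m (1 / d)"
  have K: "K \<in> unip_real m" unfolding K_def using b by (intro conj_scale_unip) auto
  have Kix: "K $$ (i, Suc i) = (if i = 0 then d else 1) * b1 $$ (i, Suc i)" if "Suc i < m" for i
    unfolding K_def using conj_scale_index[OF unip_real_carrier[OF b(1)], of i "Suc i" d "1 / d"] that by simp
  have B1_0: "glue_b1 b1 h $$ (0, Suc 0) = a * h $$ (0, 0) / d"
    using K m2 unfolding glue_b1_def K_def[symmetric] unip_real_iff by auto
  have B1_Suc: "glue_b1 b1 h $$ (Suc i, Suc (Suc i)) = K $$ (i, Suc i)" if "Suc i < m" for i
    using that K unfolding glue_b1_def K_def[symmetric] by (auto simp: unip_real_iff)
  have "(\<Sum>j = 1..Suc m - 1. of_int (rev_tuple (Suc m) M j) * glue_b1 b1 h $$ (j - 1, j))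
    = (\<Sum>j<m. of_int (M (m - j)) * glue_b1 b1 h $$ (j, Suc j))"
    by (simp add: rev_tuple_def sum.atLeast1_atMost_eq)
  also have "\<dots> = of_int (M m) * (a * h $$ (0, 0) / d) + (\<Sum>j<m - 1. of_int (M (m - Suc j)) * K $$ (j, Suc j))"
    using B1_0 B1_Suc m2 by (cases m) (auto simp: sum.lessThan_Suc_shift simp del: sum.lessThan_Suc)
  \<comment> \<open>The factor \<open>d\<close> sits at \<open>j = 0\<close>, which the reversal
    pairs with the index \<open>m - 1\<close>, so it moves into \<open>?M\<close>.\<close>
  also have "(\<Sum>j<m - 1. of_int (M (m - Suc j)) * K $$ (j, Suc j))
    = (\<Sum>j<m - 1. of_int (?M (m - Suc j)) * b1 $$ (j, Suc j))"
    by (intro sum.cong refl) (auto simp: Kix)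
  also have "\<dots> = (\<Sum>j = 1..m - 1. of_int (rev_tuple m ?M j) * b1 $$ (j - 1, j))"
    by (simp add: rev_tuple_def sum.atLeast1_atMost_eq)
  finally have psi1: "psi (Suc m) (rev_tuple (Suc m) M) (glue_b1 b1 h)
    = e (of_int (M m) * (a * h $$ (0, 0) / d)) * psi m (rev_tuple m ?M) b1"
    unfolding psi_def by (simp add: e_add)
  have B2_last: "glue_b2 b2 h $$ (m - 1, m) = h $$ (1, 1) / d + of_int k * h $$ (1, 1)"
  proof -
    have "glue_b2 b2 h $$ (m - 1, m) = a * of_int b * h $$ (1, 1) / d"
      using m2 b unfolding glue_b2_def unip_real_iff by auto
    then show ?thesis unfolding ab by (simp add: field_simps)
  qed
  have B2_ix: "glue_b2 b2 h $$ (j, Suc j) = b2 $$ (j, Suc j)" if "Suc j < m" for j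
    using that b unfolding glue_b2_def unip_real_iff by auto
  have "(\<Sum>j = 1..Suc m - 1. of_int (N j) * glue_b2 b2 h $$ (j - 1, j))
    = (\<Sum>j<m. of_int (N (Suc j)) * glue_b2 b2 h $$ (j, Suc j))"
    by (simp add: sum.atLeast1_atMost_eq)
  also have "\<dots> = (\<Sum>j<m - 1. of_int (N (Suc j)) * b2 $$ (j, Suc j))
      + of_int (N m) * (h $$ (1, 1) / d + of_int k * h $$ (1, 1))"
    using B2_last B2_ix m2 by (cases m) auto
  also have "(\<Sum>j<m - 1. of_int (N (Suc j)) * b2 $$ (j, Suc j))
    = (\<Sum>j = 1..m - 1. of_int (N j) * b2 $$ (j - 1, j))"
    by (simp add: sum.atLeast1_atMost_eq)
  finally have psi2: "psi (Suc m) N (glue_b2 b2 h)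
    = psi m N b2 * e (of_int (N m) * (h $$ (1, 1) / d)) * e (of_int (N m) * (of_int k * h $$ (1, 1)))"
    unfolding psi_def by (simp add: ring_distribs add.assoc flip: e_add)
  \<comment> \<open>The excess of the last entry of \<open>glue_b2\<close> over
    \<open>h $$ (1, 1) / d\<close> is an integer and disappears under \<open>e\<close>.\<close>
  have "e (of_int (N m) * (of_int k * h $$ (1, 1))) = 1"
    using H(2)[of 1 1] by (intro e_Ints) auto
  moreover have "psi 2 (rev_tuple 2 (\<lambda>_. int (D (m - 1)) * M m)) (mu 2 (\<lambda>_. D m) h)
    = e (of_int (M m) * (a * h $$ (0, 0) / d))"
    using H(5) by (simp add: psi_def rev_tuple_def mult_ac)
  moreover have "psi 2 (\<lambda>_. N m) (mu' 2 (\<lambda>_. D m) h) = e (of_int (N m) * (h $$ (1, 1) / d))"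
    using H(6) by (simp add: psi_def)
  ultimately show ?thesis
    unfolding phase_def glue_C_set(2,3)[OF g h] b1_def[symmetric] b2_def[symmetric] psi1 psi2
    by simp
qed

section \<open>Compatibility of gluing with double cosets\<close>

lemma glue_blocks_carrier:
  assumes "g \<in> carrier_mat m m"
  shows "scale m d * g \<in> carrier_mat m m"
  using assms by (simp add: mult_square_carrier)

text \<open>Left translation of \<open>g1\<close> by \<open>u\<close> becomes left translation by
  the conjugate \<open>U\<close>, which stays integral. A change of \<open>h $$ (1, 1)\<close> by a
  multiple of \<open>d\<close> is absorbed by adding columns of the lower left block to the last
  column.\<close>

lemma glue_cong:
  assumes g: "g1 \<in> C_set m D" "g2 \<in> double_coset m g1"
    and h: "h1 \<in> C_set 2 (\<lambda>_. D m)" "h2 \<in> double_coset 2 h1"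
  shows "glue g2 h2 \<in> double_coset (Suc m) (glue g1 h1)"
proof -
  have pos2: "pos_tuple 2 (\<lambda>_. D m)" by (simp add: pos_tuple_def)
  note g2 = mem_double_cosetD(1)[OF pos_m g] and h2 = mem_double_cosetD(1)[OF pos2 h]
  obtain u v where uv: "u \<in> unip_int m" "v \<in> unip_int m" "g2 = u * g1 * v"
    using g(2) by (auto simp: double_coset_def)
  obtain t where t: "t \<in> \<int>" "h2 $$ (1, 1) = h1 $$ (1, 1) + t * d"
    using double_coset_two_mod[OF d_pos h] by blast
  have SL: "g1 \<in> SL_int m" using g by (simp add: C_set_iff)
  obtain g' where g': "g' \<in> SL_int m" "g1 * g' = 1\<^sub>m m" using SL_int_inverse[OF SL] by metis
  have c: "g1 \<in> carrier_mat m m" "g2 \<in> carrier_mat m m" "g' \<in> carrier_mat m m"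
    "u \<in> carrier_mat m m" "v \<in> carrier_mat m m"
    using SL g' g2 uv by (auto simp: C_set_iff SL_int_iff unip_int_iff unip_real_carrier)
  define U where "U = scale m d * u * scale m (1 / d)"
  have U: "U \<in> unip_int m"
    using conj_scale_unip[of u m d] uv unfolding U_def unip_int_iff by simp
  then have Uc: "U \<in> carrier_mat m m" by (simp add: unip_int_iff unip_real_carrier)
  \<comment> \<open>Chosen so that \<open>scale m d * g1 * x\<close> is the difference of the two
    last columns; the matrix \<open>U\<close> fixes multiples of the first unit vector.\<close>
  define x where "x = g' * col0 m (s * of_int b * t)"
  show ?thesis
    unfolding glue_def
  proof (rule double_coset_lower_blocks[OF _ _ _ _ _ _ _ _ _ _ U uv(2)])
    show "x \<in> carrier_mat m 1" unfolding x_def using c by (intro mult_carrier_mat[of _ m m]) auto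
    show "int_mat x"
      using g' c t unfolding x_def
      by (intro int_mat_mult) (auto simp: SL_int_iff col0_def int_mat_def)
    show "scale m d * g2 = U * (scale m d * g1) * v"
      unfolding uv U_def using c scale_inverse(2)[of d m]
      by (simp add: mult_square_carrier[where n = m] assoc_mult_mat[of _ m m _ m _ m] mult_inverse_cancel[of _ m _ _ m])
    have "scale m d * g1 * x = scale m d * (g1 * x)"
      unfolding x_def using c by (intro assoc_mult_mat[of _ m m _ m _ 1] mult_carrier_mat[of _ m m]) auto
    also have "g1 * x = col0 m (s * of_int b * t)"
      unfolding x_def using c g' by (intro mult_inverse_cancel[of _ m _ _ 1]) auto
    also have "scale m d * \<dots> = col0 m (d * (s * of_int b * t))"
      using m2 by (intro scale_mult_col0) auto
    finally have "col0 m (s * of_int b * h1 $$ (1, 1)) + scale m d * g1 * x = col0 m (s * of_int b * h2 $$ (1, 1))"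
      using t(2) by (intro eq_matI) (auto simp: col0_def algebra_simps)
    then show "col0 m (s * of_int b * h2 $$ (1, 1))
      = U * (col0 m (s * of_int b * h1 $$ (1, 1)) + scale m d * g1 * x)"
      using unip_mult_col0[of U m] U m2 by (simp add: unip_int_iff)
  qed (use c glue_C_set(1)[OF g(1) h(1)] glue_C_set(1)[OF g2 h2] in
      \<open>auto simp: glue_blocks_carrier C_set_iff glue_def\<close>)
qed

text \<open>The lower left blocks recover the double coset of \<open>g1\<close>, and the last
  superdiagonal entries of \<open>mu'\<close> recover \<open>h1 $$ (1, 1)\<close> modulo
  \<open>d\<close>.\<close>

lemma glue_inject:
  assumes g: "g1 \<in> C_set m D" "g2 \<in> C_set m D"
    and h: "h1 \<in> C_set 2 (\<lambda>_. D m)" "h2 \<in> C_set 2 (\<lambda>_. D m)"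
    and eq: "glue g2 h2 \<in> double_coset (Suc m) (glue g1 h1)"
  shows "g2 \<in> double_coset m g1" "h2 \<in> double_coset 2 h1"
proof -
  obtain U V where UV: "U \<in> unip_int (Suc m)" "V \<in> unip_int (Suc m)" "glue g2 h2 = U * glue g1 h1 * V"
    using eq by (auto simp: double_coset_def)
  obtain r u where u: "r \<in> carrier_mat 1 m" "u \<in> unip_real m" "U = four_block_mat (1\<^sub>m 1) r (0\<^sub>m m 1) u"
    using unip_real_split_left[of U m] UV unfolding unip_int_iff by metis
  obtain c v where v: "c \<in> carrier_mat m 1" "v \<in> unip_real m" "V = four_block_mat v c (0\<^sub>m 1 m) (1\<^sub>m 1)" "int_mat v"
    using unip_real_split_right[of V m] UV unfolding unip_int_iff by metis
  have SL: "g1 \<in> SL_int m" "g2 \<in> SL_int m" "v \<in> SL_int m"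
    using g v by (auto simp: C_set_iff unip_int_iff intro: unip_int_SL)
  obtain g' where g': "g' \<in> SL_int m" "g1 * g' = 1\<^sub>m m" using SL_int_inverse[OF SL(1)] by metis
  obtain v' where v': "v' \<in> SL_int m" "v * v' = 1\<^sub>m m" using SL_int_inverse[OF SL(3)] by metis
  have cr: "g1 \<in> carrier_mat m m" "g2 \<in> carrier_mat m m" "u \<in> carrier_mat m m" "v \<in> carrier_mat m m"
    "g' \<in> carrier_mat m m" "v' \<in> carrier_mat m m"
    using SL u g' v' by (auto simp: SL_int_iff unip_real_carrier)
  have "scale m d * g2 = u * (scale m d * g1) * v"
  proof -
    define G where "G = scale m d * g1"
    define T where "T = mat 1 m (\<lambda>(_, j). a * h1 $$ (0, 0) * g1 $$ (0, j))"
    define t where "t = mat 1 1 (\<lambda>_. s * (a * of_int b * h1 $$ (0, 0) * h1 $$ (1, 1) - 1) / d)"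
    define z where "z = col0 m (s * of_int b * h1 $$ (1, 1))"
    have C: "G \<in> carrier_mat m m" "T \<in> carrier_mat 1 m" "t \<in> carrier_mat 1 1" "z \<in> carrier_mat m 1"
      using cr by (auto simp: G_def T_def t_def z_def mult_square_carrier)
    have C': "T + r * G \<in> carrier_mat 1 m" "t + r * z \<in> carrier_mat 1 1" "u * G \<in> carrier_mat m m" "u * z \<in> carrier_mat m 1"
      using C u cr by (auto intro: mult_carrier_mat)
    have "U * glue g1 h1 = four_block_mat (T + r * G) (t + r * z) (u * G) (u * z)"
      unfolding u(3) glue_def G_def[symmetric] T_def[symmetric] t_def[symmetric] z_def[symmetric]
      by (rule block_triangular_mult(1)[OF C(2,3,1,4) cr(3) u(1)])
    then have "U * glue g1 h1 * V = four_block_mat ((T + r * G) * v) ((T + r * G) * c + (t + r * z)) (u * G * v) (u * G * c + u * z)"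
      unfolding v(3) using block_triangular_mult(2)[OF C' cr(4) v(1)] by (simp only:)
    then have "glue g2 h2 = four_block_mat ((T + r * G) * v) ((T + r * G) * c + (t + r * z)) (u * G * v) (u * G * c + u * z)"
      using UV by simp
    then show ?thesis
      unfolding glue_def G_def[symmetric]
      by (rule four_block_lower_left_eq[where k = 1 and m = m and l = m and p = 1])
        (use C C' v(1) cr in \<open>auto intro!: mult_carrier_mat[of _ _ m] add_carrier_mat simp: glue_blocks_carrier\<close>)
  qed
  then have "scale m (1 / d) * (scale m d * g2) = scale m (1 / d) * (u * (scale m d * g1) * v)"
    by simp
  then have eq: "g2 = scale m (1 / d) * u * scale m d * g1 * v"
    using cr scale_inverse(2)[of d m]
    by (simp add: mult_square_carrier[where n = m] assoc_mult_mat[of _ m m _ m _ m] mult_inverse_cancel[of _ m _ _ m])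
  define w where "w = scale m (1 / d) * u * scale m d"
  have w: "w \<in> unip_real m"
    using conj_scale_unip(1)[OF u(2), of "1 / d"] unfolding w_def by simp
  then have wc: "w \<in> carrier_mat m m" by (rule unip_real_carrier)
  \<comment> \<open>Conjugation in this direction divides the first row of \<open>u\<close> by
    \<open>d\<close> off the diagonal, so integrality of \<open>w\<close> has to come from
    expressing it by integral matrices.\<close>
  have "w = g2 * v' * g'"
    unfolding eq w_def[symmetric] using wc cr g' v'
    by (simp add: mult_square_carrier[where n = m] assoc_mult_mat[of _ m m _ m _ m] mult_inverse_cancel[of _ m _ _ m])
  then have "int_mat w"
    using SL g' v' SL_int_mult by (metis SL_int_iff)
  then have "w \<in> unip_int m" "v \<in> unip_int m"
    using w v by (auto simp: unip_int_iff)
  then show "g2 \<in> double_coset m g1"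
    unfolding double_coset_def using eq[folded w_def] by blast
  note G1 = glue_C_set[OF g(1) h(1)] and G2 = glue_C_set[OF g(2) h(2)]
  have "mu' (Suc m) D (glue g2 h2) = mu' (Suc m) D (glue g1 h1) * V"
    unfolding UV(3) by (rule C_set_translate[OF pos G1(1) UV(1,2)])
  then have "glue_b2 (mu' m D g2) h2 $$ (m - 1, m) = glue_b2 (mu' m D g1) h1 $$ (m - 1, m) + V $$ (m - 1, m)"
    unfolding G1 G2
    using unip_real_superdiag_mult[OF glue_b2_unip[OF C_set_decomp(2)[OF pos_m g(1)], of h1], of V "m - 1"] UV(2) m2
    by (simp add: unip_int_iff)
  moreover have "glue_b2 (mu' m D g) h $$ (m - 1, m) = (1 + d * of_int k) * h $$ (1, 1) / d"
    if "g \<in> C_set m D" for g h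
    using m2 unip_real_carrier[OF C_set_decomp(2)[OF pos_m that]] ab unfolding glue_b2_def
    by (auto simp: mult_ac)
  ultimately have "(1 + d * of_int k) * h2 $$ (1, 1) / d = (1 + d * of_int k) * h1 $$ (1, 1) / d + V $$ (m - 1, m)"
    using g by simp
  \<comment> \<open>The terms with \<open>k\<close> are collected into the multiple of
    \<open>d\<close>; no division by \<open>1 + d * of_int k\<close> takes place.\<close>
  then have "h2 $$ (1, 1) = h1 $$ (1, 1) + (V $$ (m - 1, m) - of_int k * (h2 $$ (1, 1) - h1 $$ (1, 1))) * d"
    by (simp add: field_simps)
  moreover have "V $$ (m - 1, m) - of_int k * (h2 $$ (1, 1) - h1 $$ (1, 1)) \<in> \<int>"
    using UV(2) C_set_two(2)[OF d_pos h(1), of 1 1] C_set_two(2)[OF d_pos h(2), of 1 1]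
    by (auto simp: unip_int_def)
  ultimately show "h2 \<in> double_coset 2 h1"
    by (intro double_coset_two[OF d_pos h])
qed

end

section \<open>Surjectivity of gluing\<close>

lemma det_antidiag_bruhat:
  assumes "u \<in> unip_real n" "v \<in> unip_real n"
  shows "det (u * antidiag n f * v) = (\<Prod>j<n. f j)"
  using assms by (simp add: unip_real_carrier det_mult[of _ n] mult_square_carrier unip_real_det det_antidiag)

context coprime_split
begin

text \<open>
  The first row of \<open>g\<close> is a Bezout combination of the first row of \<open>A\<close>, which completes the other
  rows to determinant \<open>d\<close>, and the last unit vector, which completes them to \<open>a\<close> up to sign.
\<close>

lemma complete_lower_rows:
  assumes A: "A \<in> carrier_mat m m" "int_mat A" "det A = d" and c: "cofactor A 0 (m - 1) = (-1) ^ (m - 1) * a"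
  obtains g u where "g \<in> SL_int m" "u \<in> unip_int m" "A = u * (scale m d * g)"
proof -
  define g where "g = mat m m (\<lambda>(i, j). if i = 0
    then (if j = m - 1 then (-1) ^ (m - 1) * of_int b else 0) - of_int k * A $$ (0, j) else A $$ (i, j))"
  have g: "g \<in> carrier_mat m m" by (simp add: g_def)
  have m: "0 < m" "m - 1 < m" using m2 by auto
  \<comment> \<open>Cofactors along the first row ignore that row, so \<open>g\<close> and
    \<open>A\<close> share them.\<close>
  have "cofactor g 0 j = cofactor A 0 j" for j
    unfolding cofactor_def mat_delete_def using A g
    by (auto simp: g_def intro!: arg_cong[where f = det] cong_mat)
  then have "det g = (\<Sum>j<m. g $$ (0, j) * cofactor A 0 j)"
    using laplace_expansion_row[OF g m(1)] by simp
  also have "\<dots> = (\<Sum>j<m. (if j = m - 1 then (-1) ^ (m - 1) * of_int b * cofactor A 0 j else 0)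
      - of_int k * (A $$ (0, j) * cofactor A 0 j))"
    using m by (intro sum.cong) (auto simp: g_def algebra_simps)
  also have "\<dots> = (-1) ^ (m - 1) * of_int b * cofactor A 0 (m - 1) - of_int k * det A"
    using m laplace_expansion_row[OF A(1) m(1)] by (simp add: sum_subtractf flip: sum_distrib_left)
  \<comment> \<open>The two signs cancel, leaving
    \<open>a * of_int b - d * of_int k\<close>.\<close>
  also have "\<dots> = 1"
    using ab unfolding c A(3) by (simp add: algebra_simps flip: power_mult_distrib)
  finally have "g \<in> SL_int m"
    using A g m by (auto simp: SL_int_iff int_mat_def g_def)
  moreover obtain u where "u \<in> unip_int m" "A = u * (scale m (det A) * g)"
    by (rule same_lower_rows[OF \<open>g \<in> SL_int m\<close> A(1,2) m(1)]) (auto simp: g_def)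
  ultimately show ?thesis using that A(3) by simp
qed

lemma glue_surject:
  assumes G: "G \<in> C_set (Suc m) D"
  obtains g h where "g \<in> C_set m D" "h \<in> C_set 2 (\<lambda>_. D m)" "G \<in> double_coset (Suc m) (glue g h)"
proof -
  let ?f = "ratio (Suc m) D"
  have m: "0 < m" "m = Suc (m - 1)" "1 < m" using m2 by auto
  obtain b1 b2 where "b1 \<in> unip_real (Suc m)" "b2 \<in> unip_real (Suc m)" "G = b1 * antidiag (Suc m) ?f * b2"
    using G by (auto simp: C_set_iff)
  then obtain x y T t z where xy: "x \<in> unip_real m" "y \<in> unip_real m"
    and T: "T \<in> carrier_mat 1 m" "t \<in> carrier_mat 1 1" "z \<in> carrier_mat m 1"
    and G_eq: "G = four_block_mat T t (x * antidiag m ?f * y) z"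
    using lower_left_bruhat by metis
  define A where "A = x * antidiag m ?f * y"
  have xyc: "x \<in> carrier_mat m m" "y \<in> carrier_mat m m" using xy by (auto simp: unip_real_carrier)
  then have Ac: "A \<in> carrier_mat m m" by (simp add: A_def mult_square_carrier)
  have SL: "G \<in> SL_int (Suc m)" using G by (simp add: C_set_iff)
  have G_eq: "G = four_block_mat T t A z" using G_eq by (simp add: A_def)
  have entry: "G $$ (Suc i, j) = A $$ (i, j)" "G $$ (Suc i, m) = z $$ (i, 0)" if "i < m" "j < m" for i j
    unfolding G_eq using that T Ac by auto
  have G_int: "G $$ (i, j) \<in> \<int>" if "i < Suc m" "j < Suc m" for i j
    using SL that by (auto simp: SL_int_def)
  have A_int: "int_mat A"
    using entry(1) G_int Ac unfolding int_mat_def by (metis Suc_less_eq carrier_matD less_SucI)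
  have z_int: "int_mat z"
    using entry(2) G_int T(3) unfolding int_mat_def by (metis Suc_less_eq carrier_matD less_Suc0 lessI One_nat_def)
  have detA: "det A = d"
    unfolding A_def det_antidiag_bruhat[OF xy] prod_ratio[OF pos] using m2 by (simp add: ext_def)
  \<comment> \<open>\<open>A\<close> still carries the weights of size \<open>Suc m\<close>, so
    deleting its first row and last column leaves a block of determinant
    \<open>ext (Suc m) D (m - 1) = D (m - 1)\<close>.\<close>
  obtain x' y' T' t' z' where xy': "x' \<in> unip_real (m - 1)" "y' \<in> unip_real (m - 1)"
    and T': "T' \<in> carrier_mat 1 (m - 1)" "t' \<in> carrier_mat 1 1" "z' \<in> carrier_mat (m - 1) 1"
    and A_eq: "A = four_block_mat T' t' (x' * antidiag (m - 1) ?f * y') z'"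
    using lower_left_bruhat[of x "m - 1" y ?f] xy m(2) unfolding A_def by metis
  have "mat_delete A 0 (m - 1) = x' * antidiag (m - 1) ?f * y'"
    using A_eq T' xy'[THEN unip_real_carrier]
    by (intro eq_matI) (auto simp: mat_delete_def mult_square_carrier)
  then have cof: "cofactor A 0 (m - 1) = (-1) ^ (m - 1) * a"
    unfolding cofactor_def using det_antidiag_bruhat[OF xy', of ?f] prod_ratio[OF pos, of "m - 1"] m2
    by (auto simp: ext_def)
  obtain g u where g: "g \<in> SL_int m" and u: "u \<in> unip_int m" and Ag: "A = u * (scale m d * g)"
    using complete_lower_rows[OF Ac A_int detA cof] by metis
  obtain u' where u': "u' \<in> unip_int m" "u * u' = 1\<^sub>m m" "u' * u = 1\<^sub>m m"
    using unip_int_inverse[OF u] by metis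
  obtain g' where g': "g' \<in> SL_int m" "g * g' = 1\<^sub>m m"
    using SL_int_inverse[OF g] by metis
  have c: "u \<in> carrier_mat m m" "u' \<in> carrier_mat m m" "g \<in> carrier_mat m m" "g' \<in> carrier_mat m m"
    using u u' g g' by (auto simp: unip_int_iff unip_real_carrier SL_int_iff)
  have uA: "u' * A = scale m d * g"
    unfolding Ag using c u' by (simp add: mult_square_carrier mult_inverse_cancel[of _ m _ _ m])
  have "g \<in> C_set m D"
  proof -
    \<comment> \<open>This conjugation may create denominators; the Bruhat factors of
      \<open>g\<close> need only be real, and \<open>g\<close> itself is already integral.\<close>
    define w where "w = scale m (1 / d) * (u' * x) * scale m d"
    have "u' * x \<in> unip_real m" using u' xy by (auto simp: unip_int_iff intro: unip_real_mult)
    then have w: "w \<in> unip_real m"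
      using conj_scale_unip(1)[of "u' * x" m "1 / d"] unfolding w_def by simp
    have "g = scale m (1 / d) * (u' * A)"
      unfolding uA using c scale_inverse(2)[of d m] by (simp add: mult_inverse_cancel[of _ m _ _ m])
    also have "\<dots> = w * antidiag m (ratio m D) * y"
      unfolding w_def A_def antidiag_ratio_Suc using c xyc
      by (simp add: mult_square_carrier[where n = m] assoc_mult_mat[of _ m m _ m _ m])
    finally show ?thesis using g w xy by (auto simp: C_set_iff)
  qed
  define w where "w = u' * z"
  have wc: "w \<in> carrier_mat m 1" unfolding w_def using c T by (intro mult_carrier_mat[of _ m m])
  have w_int: "int_mat w"
    unfolding w_def using u' c T z_int by (intro int_mat_mult) (auto simp: unip_int_iff)
  define w0 where "w0 = w $$ (0, 0)"
  have w0: "w0 \<in> \<int>" unfolding w0_def using w_int wc m by (auto simp: int_mat_def)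
  \<comment> \<open>Coprimality of \<open>d\<close> and \<open>w0\<close>: the row of index 1 in
    \<open>H\<close> consists of multiples of \<open>d\<close> followed by \<open>w0\<close>, and
    its product with the matching column of the inverse is 1.\<close>
  obtain X Y where XY: "X \<in> \<int>" "Y \<in> \<int>" "d * X + w0 * Y = 1"
  proof -
    let ?u = "four_block_mat (1\<^sub>m 1) (0\<^sub>m 1 m) (0\<^sub>m m 1) u'"
    have "int_mat (0\<^sub>m k l)" for k l by (simp add: int_mat_def)
    then have u_unip: "?u \<in> unip_int (Suc m)"
      using u' c unip_real_four_block_left[of u' m "0\<^sub>m 1 m"]
      by (auto simp: unip_int_iff intro!: int_mat_four_block)
    define H where "H = ?u * G"
    have H: "H \<in> SL_int (Suc m)"
      unfolding H_def using u_unip SL by (intro SL_int_mult[OF unip_int_SL])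
    have H_eq: "H = four_block_mat T t (scale m d * g) w"
      unfolding H_def G_eq using block_triangular_mult(1)[OF T(1,2) Ac T(3) c(2), of "0\<^sub>m 1 m"] T Ac
      by (simp add: uA w_def)
    obtain H' where H': "H' \<in> SL_int (Suc m)" "H * H' = 1\<^sub>m (Suc m)"
      using SL_int_inverse[OF H] by metis
    have Hc: "H \<in> carrier_mat (Suc m) (Suc m)" "H' \<in> carrier_mat (Suc m) (Suc m)"
      using H H' by (auto simp: SL_int_iff)
    have H'_int: "H' $$ (i, j) \<in> \<int>" if "i < Suc m" "j < Suc m" for i j
      using H' that by (auto simp: SL_int_def)
    have "1 = (H * H') $$ (1, 1)" unfolding H'(2) using m by simp
    also have "\<dots> = (\<Sum>j\<in>{0..<Suc m}. H $$ (1, j) * H' $$ (j, 1))"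
      using Hc m by (auto simp: scalar_prod_def)
    also have "\<dots> = (\<Sum>j\<in>{0..<m}. d * (g $$ (0, j) * H' $$ (j, 1))) + w0 * H' $$ (m, 1)"
      unfolding H_eq using T c wc m scale_mult_index[OF c(3) m(1), of _ d]
      by (auto simp: w0_def mult.assoc glue_blocks_carrier intro!: sum.cong)
    finally have "d * (\<Sum>j\<in>{0..<m}. g $$ (0, j) * H' $$ (j, 1)) + w0 * H' $$ (m, 1) = 1"
      by (simp add: sum_distrib_left)
    moreover have "(\<Sum>j\<in>{0..<m}. g $$ (0, j) * H' $$ (j, 1)) \<in> \<int>"
      using g m H'_int by (auto simp: SL_int_def intro!: Ints_sum Ints_mult)
    moreover have "H' $$ (m, 1) \<in> \<int>" using H'_int m by auto
    ultimately show ?thesis using that by blast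
  qed
  \<comment> \<open>\<open>q\<close> makes \<open>s * of_int b * q\<close>, the top of the last
    column of \<open>glue g h\<close>, congruent to \<open>w0\<close> modulo \<open>d\<close>;
    \<open>p\<close> inverts \<open>q\<close> modulo \<open>d\<close> because \<open>Y\<close>
    inverts \<open>w0\<close>.\<close>
  define p q where "p = s * of_int b * Y" and "q = s * a * w0"
  have ss: "s * s = 1" by (simp flip: power_mult_distrib)
  have "p * q = (s * s) * (a * of_int b) * (w0 * Y)"
    by (simp add: p_def q_def)
  also have "\<dots> = (1 + d * of_int k) * (1 - d * X)"
    using XY(3) unfolding ss ab by simp
  finally have "(p * q - 1) / d = of_int k - X - d * of_int k * X"
    by (simp add: field_simps)
  moreover have "p \<in> \<int>" "q \<in> \<int>" using XY w0 by (auto simp: p_def q_def)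
  ultimately obtain h where h: "h \<in> C_set 2 (\<lambda>_. D m)" "h $$ (0, 0) = p" "h $$ (1, 1) = q"
    using C_set_two_exists[OF d_pos, of p q] XY by auto
  have "s * of_int b * q = (s * s) * (a * of_int b) * w0" by (simp add: q_def)
  then have bq: "s * of_int b * q = w0 + d * (of_int k * w0)" unfolding ss ab by (simp add: algebra_simps)
  \<comment> \<open>\<open>scale m d * r\<close> is \<open>w\<close> minus the last column of
    \<open>glue g h\<close>: its top entry removes the excess \<open>d * (of_int k * w0)\<close>,
    the others supply the rest of \<open>w\<close>. The column operation is then
    \<open>g' * r\<close>, as \<open>g'\<close> cancels \<open>g\<close>.\<close>
  define r where "r = mat m 1 (\<lambda>(i, _). if i = 0 then - of_int k * w0 else w $$ (i, 0))"
  have rc: "r \<in> carrier_mat m 1" by (simp add: r_def)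
  have "G \<in> double_coset (Suc m) (glue g h)"
    unfolding glue_def G_eq
  proof (rule double_coset_lower_blocks[OF _ _ _ _ _ _ _ _ _ _ u unip_int_one])
    show "g' * r \<in> carrier_mat m 1" using c(4) rc by (rule mult_carrier_mat)
    show "int_mat (g' * r)"
      using g' c w_int w0 wc by (intro int_mat_mult) (auto simp: SL_int_iff r_def int_mat_def)
    show "A = u * (scale m d * g) * 1\<^sub>m m"
      unfolding Ag using c by (simp add: mult_square_carrier right_mult_one_mat[of _ m m])
    have "scale m d * g * (g' * r) = scale m d * (g * (g' * r))"
      using c rc by (intro assoc_mult_mat[of _ m m _ m _ 1] mult_carrier_mat[of _ m m]) auto
    also have "g * (g' * r) = r"
      using c g' rc by (intro mult_inverse_cancel[of _ m _ _ 1]) auto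
    finally have "col0 m (s * of_int b * h $$ (1, 1)) + scale m d * g * (g' * r) = w"
      unfolding h(3) bq using wc scale_mult_index[OF rc, of _ 0 d]
      by (intro eq_matI) (auto simp: col0_def r_def w0_def)
    then show "z = u * (col0 m (s * of_int b * h $$ (1, 1)) + scale m d * g * (g' * r))"
      unfolding w_def using c u' T by (simp add: mult_inverse_cancel[of _ m _ _ 1])
  qed (use c T Ac SL G_eq glue_C_set(1)[OF \<open>g \<in> C_set m D\<close> h(1)] in
      \<open>auto simp: glue_blocks_carrier C_set_iff glue_def\<close>)
  then show ?thesis using that \<open>g \<in> C_set m D\<close> h(1) by blast
qed

end

section \<open>Representatives and summation over double cosets\<close>

lemma C_set_carrier: "g \<in> C_set n D \<Longrightarrow> g \<in> carrier_mat n n"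
  by (simp add: C_set_iff SL_int_iff)

lemma some_mem_double_coset:
  assumes "g \<in> C_set n D"
  shows "(SOME h. h \<in> double_coset n g) \<in> double_coset n g"
  using double_coset_refl[OF C_set_carrier[OF assms]] by (rule someI)

lemma some_mem_X_set:
  assumes "pos_tuple n D" "x \<in> X_set n D"
  shows "(SOME g. g \<in> x) \<in> C_set n D" "x = double_coset n (SOME g. g \<in> x)"
proof -
  obtain g where g: "g \<in> C_set n D" "x = double_coset n g"
    using assms(2) by (auto simp: X_set_def)
  have gc: "g \<in> carrier_mat n n" using g(1) by (rule C_set_carrier)
  have "(SOME g. g \<in> x) \<in> x"
    unfolding g(2) by (rule some_mem_double_coset[OF g(1)])
  then show "(SOME g. g \<in> x) \<in> C_set n D" "x = double_coset n (SOME g. g \<in> x)"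
    using mem_double_cosetD(1)[OF assms(1) g(1)] double_coset_eq_iff[OF gc] double_coset_carrier[OF gc] g(2)
    by auto
qed

lemma kloosterman_phase: "kloosterman n M N D = (\<Sum>x\<in>X_set n D. phase n M N D (SOME g. g \<in> x))"
  by (simp add: kloosterman_def phase_def Let_def)

lemma phase_some:
  assumes "pos_tuple n D" "g \<in> C_set n D"
  shows "phase n M N D (SOME h. h \<in> double_coset n g) = phase n M N D g"
  by (rule mem_double_cosetD(2)[OF assms some_mem_double_coset[OF assms(2)]])

lemma sum_Times_mult:
  fixes f g :: "_ \<Rightarrow> 'a :: comm_semiring_0"
  shows "(\<Sum>(x, y)\<in>A \<times> B. f x * g y) = sum f A * sum g B"
  \<comment> \<open>Finiteness is not assumed: a sum over an infinite set is 0.\<close>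
proof (cases "finite A \<and> finite B")
  case True
  then show ?thesis by (simp add: sum_product sum.cartesian_product)
next
  case False
  then have "A = {} \<or> B = {} \<or> infinite (A \<times> B)"
    by (auto simp: finite_cartesian_product_iff)
  then show ?thesis using False by auto
qed

theorem proposition3p9:
  fixes n :: nat and M N :: "nat \<Rightarrow> int" and D :: "nat \<Rightarrow> nat"
  assumes "n \<ge> 3"
    and "\<And>k. 1 \<le> k \<Longrightarrow> k \<le> n - 1 \<Longrightarrow> D k > 0"
    and "gcd (\<Prod>k = 1..n - 2. D k) (D (n - 1)) = 1"
  shows "kloosterman n M N D =
    kloosterman (n - 1) (M(n - 2 := int (D (n - 1)) * M (n - 2))) N D *
    kloosterman 2 (\<lambda>_. int (D (n - 2)) * M (n - 1)) (\<lambda>_. N (n - 1)) (\<lambda>_. D (n - 1))"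
proof -
  define m where "m = n - 1"
  have n: "n = Suc m" "n - 1 = m" "n - 2 = m - 1" "2 \<le> m" using assms(1) by (auto simp: m_def)
  have pos: "pos_tuple (Suc m) D" using assms(2) n by (auto simp: pos_tuple_def)
  have "D (m - 1) dvd (\<Prod>k = 1..m - 1. D k)" using n by (intro dvd_prodI) auto
  moreover have "coprime (\<Prod>k = 1..m - 1. D k) (D m)"
    using assms(3) unfolding n(2,3) coprime_iff_gcd_eq_1 .
  ultimately have "coprime (D (m - 1)) (D m)"
    by (rule coprime_divisors[OF _ dvd_refl])
  then have "coprime (int (D (m - 1))) (int (D m))" by simp
  then obtain b where "[int (D (m - 1)) * b = 1] (mod int (D m))"
    using cong_solve_coprime_int by blast
  then obtain k where k: "int (D (m - 1)) * b = 1 + int (D m) * k"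
    by (metis cong_iff_lin cong_sym)
  interpret coprime_split m D b k
    using n pos k by unfold_locales auto
  let ?D2 = "\<lambda>_ :: nat. D m"
  have pos2: "pos_tuple 2 ?D2" by (simp add: pos_tuple_def)
  define rep :: "real mat set \<Rightarrow> real mat" where "rep x = (SOME g. g \<in> x)" for x
  \<comment> \<open>\<open>F\<close> glues the very representatives at which the sums of sizes
    \<open>m\<close> and 2 are evaluated.\<close>
  define F where "F = (\<lambda>(x, y). double_coset (Suc m) (glue (rep x) (rep y)))"
  note rep1 = some_mem_X_set[OF pos_m, folded rep_def] and rep2 = some_mem_X_set[OF pos2, folded rep_def]
  have Fc: "glue (rep x) (rep y) \<in> C_set (Suc m) D" if "x \<in> X_set m D" "y \<in> X_set 2 ?D2" for x y
    using glue_C_set(1)[OF rep1(1)[OF that(1)] rep2(1)[OF that(2)]] .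
  have "inj_on F (X_set m D \<times> X_set 2 ?D2)"
  proof (rule inj_onI, clarify)
    fix x y x' y'
    assume x: "x \<in> X_set m D" "y \<in> X_set 2 ?D2" "x' \<in> X_set m D" "y' \<in> X_set 2 ?D2"
      and "F (x, y) = F (x', y')"
    then have "glue (rep x') (rep y') \<in> double_coset (Suc m) (glue (rep x) (rep y))"
      using double_coset_refl[OF C_set_carrier[OF Fc[OF x(3,4)]]] by (simp add: F_def)
    note inj = glue_inject[OF rep1(1)[OF x(1)] rep1(1)[OF x(3)] rep2(1)[OF x(2)] rep2(1)[OF x(4)] this]
    show "x = x' \<and> y = y'"
      using inj rep1 rep2 x double_coset_eq_iff C_set_carrier by metis
  qed
  moreover have "F ` (X_set m D \<times> X_set 2 ?D2) = X_set (Suc m) D"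
  proof (intro equalityI subsetI)
    fix z assume "z \<in> F ` (X_set m D \<times> X_set 2 ?D2)"
    then show "z \<in> X_set (Suc m) D" using Fc by (auto simp: F_def X_set_def)
  next
    fix z assume "z \<in> X_set (Suc m) D"
    then obtain G where G: "G \<in> C_set (Suc m) D" "z = double_coset (Suc m) G" by (auto simp: X_set_def)
    obtain g h where gh: "g \<in> C_set m D" "h \<in> C_set 2 ?D2" "G \<in> double_coset (Suc m) (glue g h)"
      using glue_surject[OF G(1)] by metis
    let ?x = "double_coset m g" and ?y = "double_coset 2 h"
    have xy: "?x \<in> X_set m D" "?y \<in> X_set 2 ?D2" using gh by (auto simp: X_set_def)
    \<comment> \<open>The chosen representatives may differ from \<open>g\<close> and
      \<open>h\<close>; \<open>glue_cong\<close> makes the difference immaterial.\<close>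
    have "glue (rep ?x) (rep ?y) \<in> double_coset (Suc m) (glue g h)"
      unfolding rep_def using gh(1,2) by (intro glue_cong some_mem_double_coset)
    then have "F (?x, ?y) = double_coset (Suc m) (glue g h)"
      using double_coset_eq_iff[OF C_set_carrier[OF glue_C_set(1)[OF gh(1,2)]] C_set_carrier[OF Fc[OF xy]]]
      by (simp add: F_def)
    also have "\<dots> = z"
      using double_coset_eq_iff[OF C_set_carrier[OF glue_C_set(1)[OF gh(1,2)]] C_set_carrier[OF G(1)]] gh(3) G(2)
      by simp
    finally have "F (?x, ?y) = z" .
    then show "z \<in> F ` (X_set m D \<times> X_set 2 ?D2)" using xy by blast
  qed
  ultimately have bij: "bij_betw F (X_set m D \<times> X_set 2 ?D2) (X_set (Suc m) D)"
    by (simp add: bij_betw_def)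
  let ?M1 = "M(m - 1 := int (D m) * M (m - 1))" and ?M2 = "\<lambda>_ :: nat. int (D (m - 1)) * M m"
  have "kloosterman (Suc m) M N D = (\<Sum>p\<in>X_set m D \<times> X_set 2 ?D2. phase (Suc m) M N D (rep (F p)))"
    unfolding kloosterman_phase rep_def[symmetric] by (rule sum.reindex_bij_betw[OF bij, symmetric])
  also have "\<dots> = (\<Sum>(x, y)\<in>X_set m D \<times> X_set 2 ?D2.
      phase m ?M1 N D (rep x) * phase 2 ?M2 (\<lambda>_. N m) ?D2 (rep y))"
  proof (intro sum.cong refl, clarify)
    fix x y assume "x \<in> X_set m D" "y \<in> X_set 2 ?D2"
    \<comment> \<open>The representative of \<open>F (x, y)\<close> need not be the glued matrix,
      but \<open>phase_some\<close> gives both the same phase.\<close>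
    then show "phase (Suc m) M N D (rep (F (x, y))) =
      phase m ?M1 N D (rep x) * phase 2 ?M2 (\<lambda>_. N m) ?D2 (rep y)"
      using phase_some[OF pos Fc, of x y M N] phase_glue[OF rep1(1) rep2(1), of x y M N]
      by (simp add: F_def rep_def)
  qed
  also have "\<dots> = kloosterman m ?M1 N D * kloosterman 2 ?M2 (\<lambda>_. N m) ?D2"
    unfolding sum_Times_mult kloosterman_phase rep_def ..
  finally show ?thesis unfolding n by simp
qed

end
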